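(* The scaling and wavelet subspaces $V_0$ and $W_0$ satisfy the two-scale relation $$V_0\oplus W_0=A_4V_0 .$$
   Context: Fourier transform: $\widehat f(\xi)=\int f(x)e^{-2\pi i x\cdot\xi}dx$, extended to $L^2$. A family $\{\varphi_i\}$ is an $a$-tight frame for $\mathcal H$ if $\sum_i|\langle f,\varphi_i\rangle|^2=a\|f\|^2$ for all $f\in\mathcal H$. Let $\phi$ be an orthogonal scaling function of a $16$-band multiresolution analysis (dilation factor $16$) in $L^2(\mathbb R)$, with associated orthonormal wavelets $\psi_1,\dots,\psi_{15}$. Let $b>0$ and let $w\in L^2(\mathbb R)$ be a unit-norm window such that the functions $x\mapsto e^{2\pi i m b x}w(x-k)$, $m,k\in\mathbb Z$, form a $b^{-1}$-tight frame for $L^2(\mathbb R)$. For $\xi=(\xi_1,\xi_2)$ with $\xi_1\neq0$ put $\gamma_1(\xi)=\frac12\mathrm{sgn}(\xi_1)\xi_1^2$ and $\gamma_2(\xi)=\xi_2/\xi_1$. For $k\in\mathbb Z$, $m=(m_1,m_2)\in\mathbb Z^2$, $1\le\ell\le15$, define $\Phi_{0,k,m},\Psi^\ell_{0,k,m}\in L^2(\mathbb R^2)$ by $$\widehat{\Phi_{0,k,m}}(\xi)=\widehat\phi(\gamma_1(\xi))\,w(\gamma_2(\xi)-k)\,e^{2\pi i m_1\gamma_1(\xi)}e^{2\pi i m_2 b\gamma_2(\xi)},$$ $$\widehat{\Psi^\ell_{0,k,m}}(\xi)=\widehat\psi_\ell(\gamma_1(\xi))\,w(\gamma_2(\xi)-k)\,e^{2\pi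 i m_1\gamma_1(\xi)}e^{2\pi i m_2 b\gamma_2(\xi)}.$$ $V_0=\overline{\mathrm{span}}\{\Phi_{0,k,m}:k\in\mathbb Z,m\in\mathbb Z^2\}$ and $W_0=\overline{\mathrm{span}}\{\Psi^\ell_{0,k,m}:k\in\mathbb Z,m\in\mathbb Z^2,\ell=1,\dots,15\}$ are closed subspaces of $L^2(\mathbb R^2)$. For $j\in\mathbb Z$, $A_j$ is the dilation operator acting on $f\in L^2(\mathbb R^2)$ in the frequency domain by $A_j\widehat f(\xi_1,\xi_2)=2^{-3j/2}\widehat f(2^{-2j}\xi_1,2^{-j}\xi_2)$; $A_jV_0$ is the space of functions whose Fourier transforms are $A_j\widehat f$, $f\in V_0$.
   Formalization: With the stated definition of A_j, the relation fails for index j=4 (A_4V_0 is strictly larger than V_0⊕W_0); the formal statement proves V_0⊕W_0 = A_1V_0, reading the subscript 4 as the dilation factor 4 of ξ_1. *)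

theory Defs
  imports "HOL-Analysis.Analysis"
begin

section \<open>Square-integrable functions\<close>

text \<open>Elements of \<open>L\<^sup>2\<close> are represented by Borel functions that are not identified
  almost everywhere. Convergence is with respect to the seminorm, so all closed subspaces
  below are saturated under almost-everywhere equality, and equality of such sets of
  functions is equality of subspaces of \<open>L\<^sup>2\<close>.\<close>

definition L2 :: "('a::euclidean_space \<Rightarrow> complex) set" where
  "L2 = {f. f \<in> borel_measurable lborel \<and> integrable lborel (\<lambda>x. (cmod (f x))\<^sup>2)}"

definition l2inner :: "('a::euclidean_space \<Rightarrow> complex) \<Rightarrow> ('a \<Rightarrow> complex) \<Rightarrow> complex" where
  "l2inner f g = (LINT x|lborel. f x * cnj (g x))"

definition l2norm :: "('a::euclidean_space \<Rightarrow> complex) \<Rightarrow> real" where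
  "l2norm f = sqrt (LINT x|lborel. (cmod (f x))\<^sup>2)"

definition l2_tendsto ::
  "(nat \<Rightarrow> 'a::euclidean_space \<Rightarrow> complex) \<Rightarrow> ('a \<Rightarrow> complex) \<Rightarrow> bool" where
  "l2_tendsto u f \<longleftrightarrow> (\<forall>n. u n \<in> L2) \<and> f \<in> L2 \<and>
     (\<lambda>n. l2norm (\<lambda>x. u n x - f x)) \<longlonglongrightarrow> 0"

definition lin_span :: "('a \<Rightarrow> complex) set \<Rightarrow> ('a \<Rightarrow> complex) set" where
  "lin_span S = {(\<lambda>x. \<Sum>h\<in>T. c h * h x) | T c. finite T \<and> T \<subseteq> S}"

definition closed_span :: "('a::euclidean_space \<Rightarrow> complex) set \<Rightarrow> ('a \<Rightarrow> complex) set" where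
  "closed_span S = {f. \<exists>u. (\<forall>n. u n \<in> lin_span S) \<and> l2_tendsto u f}"

definition closed_subspace :: "('a::euclidean_space \<Rightarrow> complex) set \<Rightarrow> bool" where
  "closed_subspace U \<longleftrightarrow> U \<subseteq> L2 \<and> (\<lambda>x. 0) \<in> U \<and>
     (\<forall>f\<in>U. \<forall>g\<in>U. (\<lambda>x. f x + g x) \<in> U) \<and>
     (\<forall>c. \<forall>f\<in>U. (\<lambda>x. c * f x) \<in> U) \<and>
     (\<forall>u f. (\<forall>n. u n \<in> U) \<and> l2_tendsto u f \<longrightarrow> f \<in> U)"

definition is_orthogonal_sum ::
  "('a::euclidean_space \<Rightarrow> complex) set \<Rightarrow> ('a \<Rightarrow> complex) set \<Rightarrow> ('a \<Rightarrow> complex) set \<Rightarrow> bool" where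
  "is_orthogonal_sum U W S \<longleftrightarrow>
     (\<forall>f\<in>U. \<forall>g\<in>W. l2inner f g = 0) \<and> {(\<lambda>x. f x + g x) | f g. f \<in> U \<and> g \<in> W} = S"

definition orthonormal_basis ::
  "('a::euclidean_space \<Rightarrow> complex) set \<Rightarrow> 'i set \<Rightarrow> ('i \<Rightarrow> 'a \<Rightarrow> complex) \<Rightarrow> bool" where
  "orthonormal_basis U I e \<longleftrightarrow> (\<forall>i\<in>I. e i \<in> L2) \<and>
     (\<forall>i\<in>I. \<forall>j\<in>I. l2inner (e i) (e j) = (if i = j then 1 else 0)) \<and>
     closed_span (e ` I) = U"

definition tight_frame ::
  "real \<Rightarrow> ('a::euclidean_space \<Rightarrow> complex) set \<Rightarrow> 'i set \<Rightarrow> ('i \<Rightarrow> 'a \<Rightarrow> complex) \<Rightarrow> bool" where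
  "tight_frame a H I e \<longleftrightarrow> (\<forall>i\<in>I. e i \<in> H) \<and>
     (\<forall>f\<in>H. ((\<lambda>i. (cmod (l2inner f (e i)))\<^sup>2) has_sum a * (l2norm f)\<^sup>2) I)"


section \<open>Fourier transform\<close>

definition fourier_integral ::
  "('a::euclidean_space \<Rightarrow> complex) \<Rightarrow> 'a \<Rightarrow> complex" where
  "fourier_integral f \<xi> = (LINT x|lborel. f x * cis (- 2 * pi * (x \<bullet> \<xi>)))"

text \<open>The graph of the extension of \<open>fourier_integral\<close> by continuity from
  \<open>L\<^sup>1 \<inter> L\<^sup>2\<close> to \<open>L\<^sup>2\<close>.\<close>

definition has_fourier ::
  "('a::euclidean_space \<Rightarrow> complex) \<Rightarrow> ('a \<Rightarrow> complex) \<Rightarrow> bool" where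
  "has_fourier f g \<longleftrightarrow> (\<exists>u. (\<forall>n. integrable lborel (u n)) \<and> l2_tendsto u f \<and>
     l2_tendsto (\<lambda>n. fourier_integral (u n)) g)"

text \<open>Both functions below pick a representative; it is determined up to a null set.\<close>

definition fourier :: "('a::euclidean_space \<Rightarrow> complex) \<Rightarrow> 'a \<Rightarrow> complex" where
  "fourier f = (SOME g. has_fourier f g)"

definition inverse_fourier :: "('a::euclidean_space \<Rightarrow> complex) \<Rightarrow> 'a \<Rightarrow> complex" where
  "inverse_fourier g = (SOME f. has_fourier f g)"


section \<open>Multiresolution analyses of \<open>L\<^sup>2(\<real>)\<close>\<close>

definition mra :: "nat \<Rightarrow> (int \<Rightarrow> (real \<Rightarrow> complex) set) \<Rightarrow> (real \<Rightarrow> complex) \<Rightarrow> bool" where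
  "mra N V \<phi> \<longleftrightarrow>
     (\<forall>j. closed_subspace (V j)) \<and>
     (\<forall>j. V j \<subseteq> V (j + 1)) \<and>
     (\<forall>j f. f \<in> V j \<longleftrightarrow> (\<lambda>x. f (of_nat N * x)) \<in> V (j + 1)) \<and>
     (\<forall>f\<in>(\<Inter>j. V j). AE x in lborel. f x = 0) \<and>
     (\<forall>f\<in>L2. \<exists>u. (\<forall>n. u n \<in> (\<Union>j. V j)) \<and> l2_tendsto u f) \<and>
     orthonormal_basis (V 0) UNIV (\<lambda>(k::int) x. \<phi> (x - of_int k))"

text \<open>The integer translates of the \<open>N - 1\<close> wavelets \<open>\<psi> 1, \<dots>, \<psi> (N - 1)\<close> form an
  orthonormal basis of the orthogonal complement of \<open>V 0\<close> in \<open>V 1\<close>.\<close>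

definition mra_wavelets ::
  "nat \<Rightarrow> (int \<Rightarrow> (real \<Rightarrow> complex) set) \<Rightarrow> (nat \<Rightarrow> real \<Rightarrow> complex) \<Rightarrow> bool" where
  "mra_wavelets N V \<psi> \<longleftrightarrow>
     orthonormal_basis {f \<in> V 1. \<forall>g\<in>V 0. l2inner f g = 0} ({1..N - 1} \<times> (UNIV :: int set))
       (\<lambda>(l, k) x. \<psi> l (x - of_int k))"


section \<open>The spaces in \<open>L\<^sup>2(\<real>\<^sup>2)\<close>\<close>

text \<open>The values on the null set where the first coordinate vanishes are irrelevant.\<close>

definition gamma1 :: "real \<times> real \<Rightarrow> real" where
  "gamma1 \<xi> = 1 / 2 * sgn (fst \<xi>) * (fst \<xi>)\<^sup>2"

definition gamma2 :: "real \<times> real \<Rightarrow> real" where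
  "gamma2 \<xi> = snd \<xi> / fst \<xi>"

definition atom_hat ::
  "(real \<Rightarrow> complex) \<Rightarrow> (real \<Rightarrow> complex) \<Rightarrow> real \<Rightarrow> int \<Rightarrow> int \<times> int \<Rightarrow> real \<times> real \<Rightarrow> complex" where
  "atom_hat h w b k m \<xi> =
     fourier h (gamma1 \<xi>) * w (gamma2 \<xi> - of_int k) *
     cis (2 * pi * of_int (fst m) * gamma1 \<xi>) * cis (2 * pi * of_int (snd m) * b * gamma2 \<xi>)"

definition Phi0 ::
  "(real \<Rightarrow> complex) \<Rightarrow> (real \<Rightarrow> complex) \<Rightarrow> real \<Rightarrow> int \<Rightarrow> int \<times> int \<Rightarrow> real \<times> real \<Rightarrow> complex" where
  "Phi0 \<phi> w b k m = inverse_fourier (atom_hat \<phi> w b k m)"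

definition Psi0 ::
  "(nat \<Rightarrow> real \<Rightarrow> complex) \<Rightarrow> (real \<Rightarrow> complex) \<Rightarrow> real \<Rightarrow> nat \<Rightarrow> int \<Rightarrow> int \<times> int \<Rightarrow>
     real \<times> real \<Rightarrow> complex" where
  "Psi0 \<psi> w b l k m = inverse_fourier (atom_hat (\<psi> l) w b k m)"

definition V0_space ::
  "(real \<Rightarrow> complex) \<Rightarrow> (real \<Rightarrow> complex) \<Rightarrow> real \<Rightarrow> (real \<times> real \<Rightarrow> complex) set" where
  "V0_space \<phi> w b = closed_span {Phi0 \<phi> w b k m | k m. True}"

definition W0_space ::
  "(nat \<Rightarrow> real \<Rightarrow> complex) \<Rightarrow> (real \<Rightarrow> complex) \<Rightarrow> real \<Rightarrow> (real \<times> real \<Rightarrow> complex) set" where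
  "W0_space \<psi> w b = closed_span {Psi0 \<psi> w b l k m | l k m. l \<in> {1..15}}"

definition dilation_hat :: "int \<Rightarrow> (real \<times> real \<Rightarrow> complex) \<Rightarrow> real \<times> real \<Rightarrow> complex" where
  "dilation_hat j g = (\<lambda>(\<xi>1, \<xi>2).
     of_real (2 powr (- 3 * of_int j / 2)) * g (2 powi (- 2 * j) * \<xi>1, 2 powi (- j) * \<xi>2))"

definition dilated_space ::
  "int \<Rightarrow> (real \<times> real \<Rightarrow> complex) set \<Rightarrow> (real \<times> real \<Rightarrow> complex) set" where
  "dilated_space j U = {F. \<exists>f\<in>U. has_fourier F (dilation_hat j (fourier f))}"

text \<open>The index \<open>j\<close> counts steps: \<open>dilation_hat j\<close> rescales the first coordinate by
  \<open>4\<^sup>j\<close>, hence \<open>gamma1\<close> by \<open>16\<^sup>j\<close>. The operator written \<open>A\<^sub>4\<close> in the two-scale relation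
  carries the dilation factor 4 of the first coordinate as its subscript; it is
  \<open>dilation_hat 1\<close>, one step of a 16-band analysis. The relation is false for \<open>j = 4\<close>,
  which rescales \<open>gamma1\<close> by \<open>16\<^sup>4\<close> and so leads four levels up.\<close>

lemma gamma_scaling:
  "gamma1 (2 powi (- 2 * j) * \<xi>1, 2 powi (- j) * \<xi>2) = 16 powi (- j) * gamma1 (\<xi>1, \<xi>2)"
  "gamma2 (2 powi (- 2 * j) * \<xi>1, 2 powi (- j) * \<xi>2) = 2 powi j * gamma2 (\<xi>1, \<xi>2)"
proof -
  have 1: "(2 powi (- 2 * j))\<^sup>2 = (16 powi (- j) :: real)"
  proof -
    have "(2 powi (- 2 * j))\<^sup>2 = (2 powi (4 * (- j)) :: real)"
      by (simp add: power2_eq_square flip: power_int_add)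
    also have "\<dots> = (2 powi 4) powi (- j)"
      by (rule power_int_mult)
    finally show ?thesis by simp
  qed
  show "gamma1 (2 powi (- 2 * j) * \<xi>1, 2 powi (- j) * \<xi>2) = 16 powi (- j) * gamma1 (\<xi>1, \<xi>2)"
    unfolding gamma1_def fst_conv power_mult_distrib 1 sgn_mult by simp
  have 2: "2 powi (- j) = 2 powi j * (2 powi (- 2 * j) :: real)"
    by (simp flip: power_int_add)
  show "gamma2 (2 powi (- 2 * j) * \<xi>1, 2 powi (- j) * \<xi>2) = 2 powi j * gamma2 (\<xi>1, \<xi>2)"
    unfolding gamma2_def fst_conv snd_conv 2 by simp
qed

end

theory Submission
  imports Defs "HOL-Probability.Characteristic_Functions"
begin

text \<open>The map \<open>\<xi> \<mapsto> (gamma1 \<xi>, gamma2 \<xi>)\<close> preserves Lebesgue measure, so on the Fourier side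
  \<open>V\<^sub>0\<close> and \<open>W\<^sub>0\<close> are the pullbacks of the closed tensor products of the Fourier images of the
  scaling and the wavelet space with \<open>L\<^sup>2(\<real>)\<close>, because a tight frame is total. The dilation acts on
  the first factor as dilation by 16 and on the second factor as a bijection, so the claim reduces to
  the one-dimensional identity \<open>V 1 = V 0 \<oplus> W\<close>. Plancherel's theorem is obtained from
  modulated and translated Gaussians: the Fourier transform permutes them up to unimodular factors
  and preserves their inner products, and they are total in \<open>L\<^sup>2\<close>.\<close>

section \<open>The space of square-integrable functions\<close>

lemma L2_D:
  assumes "f \<in> L2"
  shows "f \<in> borel_measurable borel" "integrable lborel (\<lambda>x. (cmod (f x))\<^sup>2)"
  using assms by (auto simp: L2_def)

lemma L2_mult_integrable:
  assumes "f \<in> L2" "g \<in> L2"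
  shows "integrable lborel (\<lambda>x. f x * g x)"
proof (rule Bochner_Integration.integrable_bound)
  note [measurable] = L2_D(1)[OF assms(1)] L2_D(1)[OF assms(2)]
  show "integrable lborel (\<lambda>x. (cmod (f x))\<^sup>2 + (cmod (g x))\<^sup>2)"
    using assms by (auto simp: L2_def)
  show "(\<lambda>x. f x * g x) \<in> borel_measurable lborel" by measurable
  have "a * b \<le> a\<^sup>2 + b\<^sup>2" if "a \<ge> 0" "b \<ge> 0" for a b :: real
  proof -
    have "0 \<le> a * b" using that by simp
    moreover have "0 \<le> (a - b)\<^sup>2" by simp
    ultimately show ?thesis unfolding power2_diff by linarith
  qed
  then show "AE x in lborel. norm (f x * g x) \<le> norm ((cmod (f x))\<^sup>2 + (cmod (g x))\<^sup>2)"
    by (simp add: norm_mult)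
qed

lemma borel_measurable_cnj [measurable (raw)]:
  "f \<in> borel_measurable M \<Longrightarrow> (\<lambda>x. cnj (f x)) \<in> borel_measurable M"
  by (rule borel_measurable_continuous_on[OF _, of cnj]) (auto intro: continuous_intros)

lemma L2_cnj: "f \<in> L2 \<Longrightarrow> (\<lambda>x. cnj (f x)) \<in> L2"
  by (auto simp: L2_def)

lemma l2inner_integrable: "f \<in> L2 \<Longrightarrow> g \<in> L2 \<Longrightarrow> integrable lborel (\<lambda>x. f x * cnj (g x))"
  using L2_mult_integrable L2_cnj by blast

lemma L2_zero [simp]: "(\<lambda>x. 0) \<in> L2"
  by (auto simp: L2_def)

lemma L2_scale: "f \<in> L2 \<Longrightarrow> (\<lambda>x. c * f x) \<in> L2"
  by (auto simp: L2_def norm_mult power_mult_distrib)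

lemma L2_add:
  assumes "f \<in> L2" "g \<in> L2"
  shows "(\<lambda>x. f x + g x) \<in> L2"
proof -
  note [measurable] = L2_D(1)[OF assms(1)] L2_D(1)[OF assms(2)]
  have "(cmod (u + v))\<^sup>2 \<le> 2 * (cmod u)\<^sup>2 + 2 * (cmod v)\<^sup>2" for u v
  proof -
    have "(cmod (u + v))\<^sup>2 \<le> (cmod u + cmod v)\<^sup>2" by (simp add: norm_triangle_ineq power_mono)
    also have "\<dots> \<le> 2 * (cmod u)\<^sup>2 + 2 * (cmod v)\<^sup>2"
      using zero_le_power2[of "cmod u - cmod v"] by (simp add: power2_eq_square algebra_simps)
    finally show ?thesis .
  qed
  moreover have "integrable lborel (\<lambda>x. 2 * (cmod (f x))\<^sup>2 + 2 * (cmod (g x))\<^sup>2)"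
    using assms by (auto simp: L2_def)
  ultimately have "integrable lborel (\<lambda>x. (cmod (f x + g x))\<^sup>2)"
    by (elim Bochner_Integration.integrable_bound) (simp_all)
  then show ?thesis by (auto simp: L2_def)
qed

lemma L2_diff: "f \<in> L2 \<Longrightarrow> g \<in> L2 \<Longrightarrow> (\<lambda>x. f x - g x) \<in> L2"
  using L2_add[of f "\<lambda>x. - 1 * g x"] L2_scale[of g "- 1"] by simp

lemma l2inner_add_left:
  "f \<in> L2 \<Longrightarrow> g \<in> L2 \<Longrightarrow> h \<in> L2 \<Longrightarrow> l2inner (\<lambda>x. f x + g x) h = l2inner f h + l2inner g h"
  by (simp add: l2inner_def distrib_right l2inner_integrable)

lemma l2inner_diff_left:
  "f \<in> L2 \<Longrightarrow> g \<in> L2 \<Longrightarrow> h \<in> L2 \<Longrightarrow> l2inner (\<lambda>x. f x - g x) h = l2inner f h - l2inner g h"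
  by (simp add: l2inner_def left_diff_distrib l2inner_integrable)

lemma l2inner_scale_left: "l2inner (\<lambda>x. c * f x) h = c * l2inner f h"
  by (simp add: l2inner_def mult.assoc)

lemma l2inner_commute: "l2inner g f = cnj (l2inner f g)"
proof -
  have "l2inner g f = (LINT x|lborel. cnj (f x * cnj (g x)))"
    by (simp add: l2inner_def mult.commute)
  then show ?thesis unfolding Bochner_Integration.integral_cnj l2inner_def .
qed

lemma l2inner_diff_right:
  "f \<in> L2 \<Longrightarrow> g \<in> L2 \<Longrightarrow> h \<in> L2 \<Longrightarrow> l2inner h (\<lambda>x. f x - g x) = l2inner h f - l2inner h g"
  by (simp add: l2inner_def right_diff_distrib l2inner_integrable)

lemma l2inner_scale_right: "l2inner h (\<lambda>x. c * f x) = cnj c * l2inner h f"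
  by (subst l2inner_commute) (simp add: l2inner_scale_left l2inner_commute[of f h])

lemma l2inner_zero_left [simp]: "l2inner (\<lambda>x. 0) f = 0"
  and l2inner_zero_right [simp]: "l2inner f (\<lambda>x. 0) = 0"
  by (simp_all add: l2inner_def)

lemma l2norm_nonneg [simp]: "0 \<le> l2norm f"
  by (simp add: l2norm_def)

lemma l2norm_zero [simp]: "l2norm (\<lambda>x. 0) = 0"
  by (simp add: l2norm_def)

lemma l2norm_power2: "(l2norm f)\<^sup>2 = (LINT x|lborel. (cmod (f x))\<^sup>2)"
  by (simp add: l2norm_def)

lemma l2inner_self: "l2inner f f = of_real ((l2norm f)\<^sup>2)"
  unfolding l2inner_def l2norm_power2 complex_norm_square[symmetric] integral_complex_of_real ..

lemma l2norm_scale: "l2norm (\<lambda>x. c * f x) = cmod c * l2norm f"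
  by (simp add: l2norm_def norm_mult power_mult_distrib real_sqrt_mult)

lemma l2norm_minus_commute: "l2norm (\<lambda>x. f x - g x) = l2norm (\<lambda>x. g x - f x)"
  by (simp add: l2norm_def norm_minus_commute)

lemma l2norm_eq_0_iff:
  assumes "f \<in> L2"
  shows "l2norm f = 0 \<longleftrightarrow> (AE x in lborel. f x = 0)"
  using integral_nonneg_eq_0_iff_AE[OF L2_D(2)[OF assms]] by (simp add: l2norm_def)

lemma l2norm_cong_AE:
  assumes "f \<in> borel_measurable borel" "g \<in> borel_measurable borel" "AE x in lborel. f x = g x"
  shows "l2norm f = l2norm g"
  unfolding l2norm_def using assms by (intro arg_cong[where f=sqrt] integral_cong_AE) auto

lemma L2_cong_AE:
  assumes "f \<in> L2" "g \<in> borel_measurable borel" "AE x in lborel. f x = g x"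
  shows "g \<in> L2"
proof -
  note [measurable] = L2_D(1)[OF assms(1)] assms(2)
  have "integrable lborel (\<lambda>x. (cmod (g x))\<^sup>2) \<longleftrightarrow> integrable lborel (\<lambda>x. (cmod (f x))\<^sup>2)"
    using assms(3) by (intro integrable_cong_AE) auto
  then show ?thesis using assms by (auto simp: L2_def)
qed

lemma l2norm_diff_power2:
  assumes "f \<in> L2" "g \<in> L2"
  shows "(l2norm (\<lambda>x. f x - c * g x))\<^sup>2 =
    (l2norm f)\<^sup>2 - 2 * Re (cnj c * l2inner f g) + (cmod c)\<^sup>2 * (l2norm g)\<^sup>2"
proof -
  have "complex_of_real ((l2norm (\<lambda>x. f x - c * g x))\<^sup>2) =
     of_real ((l2norm f)\<^sup>2) - cnj c * l2inner f g - cnj (cnj c * l2inner f g) + c * cnj c * of_real ((l2norm g)\<^sup>2)"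
    unfolding l2inner_self[symmetric]
    using assms
    by (simp add: l2inner_diff_left l2inner_diff_right l2inner_scale_left l2inner_scale_right L2_diff L2_scale
       l2inner_commute[of g f] algebra_simps)
  then have "Re (complex_of_real ((l2norm (\<lambda>x. f x - c * g x))\<^sup>2)) = Re(
     of_real ((l2norm f)\<^sup>2) - cnj c * l2inner f g - cnj (cnj c * l2inner f g) + c * cnj c * of_real ((l2norm g)\<^sup>2))"
    by simp
  then show ?thesis unfolding complex_norm_square[symmetric] by (simp del: of_real_power)
qed

lemma l2_Cauchy_Schwarz:
  assumes "f \<in> L2" "g \<in> L2"
  shows "cmod (l2inner f g) \<le> l2norm f * l2norm g"
proof -
  define z where "z = l2inner f g"
  have key: "2 * t * (cmod z)\<^sup>2 \<le> (l2norm f)\<^sup>2 + t\<^sup>2 * (cmod z)\<^sup>2 * (l2norm g)\<^sup>2" for t :: real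
  proof -
    have "0 \<le> (l2norm (\<lambda>x. f x - (of_real t * z) * g x))\<^sup>2" by simp
    also have "\<dots> = (l2norm f)\<^sup>2 - 2 * Re (cnj (of_real t * z) * z) + (cmod (of_real t * z))\<^sup>2 * (l2norm g)\<^sup>2"
      unfolding z_def by (rule l2norm_diff_power2[OF assms])
    also have "cnj (of_real t * z) * z = of_real (t * (cmod z)\<^sup>2)"
      unfolding of_real_mult complex_norm_square by simp
    finally show ?thesis by (simp add: norm_mult power_mult_distrib)
  qed
  have "cmod z \<le> l2norm f * l2norm g"
  proof (cases "l2norm g = 0")
    case True
    have "z = 0"
    proof (rule ccontr)
      assume "z \<noteq> 0"
      then have "2 * ((l2norm f)\<^sup>2 + 1) \<le> (l2norm f)\<^sup>2"
        using key[of "((l2norm f)\<^sup>2 + 1) / (cmod z)\<^sup>2"] True by simp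
      moreover have "\<not> 2 * (a + 1) \<le> a" if "0 \<le> a" for a :: real using that by simp
      ultimately show False by (metis zero_le_power2)
    qed
    then show ?thesis by simp
  next
    case False
    have "2 * (cmod z)\<^sup>2 / (l2norm g)\<^sup>2 \<le> (l2norm f)\<^sup>2 + (cmod z)\<^sup>2 / (l2norm g)\<^sup>2"
      using key[of "1 / (l2norm g)\<^sup>2"] False by (simp add: field_simps power2_eq_square)
    then have "(cmod z)\<^sup>2 / (l2norm g)\<^sup>2 \<le> (l2norm f)\<^sup>2" by simp
    then have "(cmod z)\<^sup>2 \<le> (l2norm f * l2norm g)\<^sup>2"
      using False by (simp add: divide_le_eq power_mult_distrib)
    then show ?thesis by (rule power2_le_imp_le) simp
  qed
  then show ?thesis by (simp add: z_def)
qed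

lemma l2norm_diff_triangle:
  assumes "f \<in> L2" "g \<in> L2"
  shows "l2norm (\<lambda>x. f x - g x) \<le> l2norm f + l2norm g"
proof (rule power2_le_imp_le)
  have "(l2norm (\<lambda>x. f x - g x))\<^sup>2 = (l2norm f)\<^sup>2 - 2 * Re (l2inner f g) + (l2norm g)\<^sup>2"
    using l2norm_diff_power2[OF assms, of 1] by simp
  also have "- Re (l2inner f g) \<le> l2norm f * l2norm g"
    using l2_Cauchy_Schwarz[OF assms] abs_Re_le_cmod[of "l2inner f g"] by linarith
  finally show "(l2norm (\<lambda>x. f x - g x))\<^sup>2 \<le> (l2norm f + l2norm g)\<^sup>2"
    by (simp add: power2_sum) (use \<open>- Re (l2inner f g) \<le> l2norm f * l2norm g\<close> in linarith)
qed simp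

lemma l2norm_triangle:
  assumes "f \<in> L2" "g \<in> L2"
  shows "l2norm (\<lambda>x. f x + g x) \<le> l2norm f + l2norm g"
  using l2norm_diff_triangle[OF assms(1) L2_scale[OF assms(2), of "-1"]] l2norm_scale[of "-1" g]
  by simp

lemma l2norm_dist_triangle:
  assumes "f \<in> L2" "g \<in> L2" "h \<in> L2"
  shows "l2norm (\<lambda>x. f x - h x) \<le> l2norm (\<lambda>x. f x - g x) + l2norm (\<lambda>x. g x - h x)"
  using l2norm_triangle[OF L2_diff[OF assms(1,2)] L2_diff[OF assms(2,3)]] by simp

lemma l2_tendsto_L2:
  assumes "l2_tendsto u f"
  shows "u n \<in> L2" "f \<in> L2"
  using assms by (auto simp: l2_tendsto_def)

lemma l2_tendsto_const: "f \<in> L2 \<Longrightarrow> l2_tendsto (\<lambda>n. f) f"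
  by (simp add: l2_tendsto_def)

lemma l2_tendstoI:
  assumes "\<And>n. u n \<in> L2" "f \<in> L2" "\<And>n. l2norm (\<lambda>x. u n x - f x) \<le> C n" "C \<longlonglongrightarrow> 0"
  shows "l2_tendsto u f"
  unfolding l2_tendsto_def
  using assms by (auto intro: tendsto_sandwich[where f="\<lambda>_. 0" and h = C])

lemma l2_tendsto_add:
  assumes "l2_tendsto u f" "l2_tendsto v g"
  shows "l2_tendsto (\<lambda>n x. u n x + v n x) (\<lambda>x. f x + g x)"
proof (rule l2_tendstoI[where C="\<lambda>n. l2norm (\<lambda>x. u n x - f x) + l2norm (\<lambda>x. v n x - g x)"])
  show "l2norm (\<lambda>x. u n x + v n x - (f x + g x)) \<le> l2norm (\<lambda>x. u n x - f x) + l2norm (\<lambda>x. v n x - g x)" for n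
    using l2norm_triangle[OF L2_diff L2_diff, of "u n" f "v n" g] assms
    by (simp add: l2_tendsto_def algebra_simps)
  show "(\<lambda>n. l2norm (\<lambda>x. u n x - f x) + l2norm (\<lambda>x. v n x - g x)) \<longlonglongrightarrow> 0"
    using assms by (auto simp: l2_tendsto_def intro: tendsto_add_zero)
qed (use assms in \<open>auto simp: l2_tendsto_def intro!: L2_add\<close>)

lemma l2_tendsto_scale:
  assumes "l2_tendsto u f"
  shows "l2_tendsto (\<lambda>n x. c * u n x) (\<lambda>x. c * f x)"
proof (rule l2_tendstoI[where C="\<lambda>n. cmod c * l2norm (\<lambda>x. u n x - f x)"])
  show "l2norm (\<lambda>x. c * u n x - c * f x) \<le> cmod c * l2norm (\<lambda>x. u n x - f x)" for n
    by (simp add: l2norm_scale flip: right_diff_distrib)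
  show "(\<lambda>n. cmod c * l2norm (\<lambda>x. u n x - f x)) \<longlonglongrightarrow> 0"
    using assms by (auto simp: l2_tendsto_def intro: tendsto_mult_right_zero)
qed (use assms in \<open>auto simp: l2_tendsto_def intro!: L2_scale\<close>)

lemma l2_tendsto_inner:
  assumes "l2_tendsto u f" "l2_tendsto v g"
  shows "(\<lambda>n. l2inner (u n) (v n)) \<longlonglongrightarrow> l2inner f g"
proof -
  note L = l2_tendsto_L2[OF assms(1)] l2_tendsto_L2[OF assms(2)]
  let ?a = "\<lambda>n. l2norm (\<lambda>x. u n x - f x)" and ?b = "\<lambda>n. l2norm (\<lambda>x. v n x - g x)"
  have ab: "?a \<longlonglongrightarrow> 0" "?b \<longlonglongrightarrow> 0" using assms by (auto simp: l2_tendsto_def)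
  have "l2inner (u n) (v n) - l2inner f g =
      l2inner (\<lambda>x. u n x - f x) (\<lambda>x. v n x - g x) + l2inner (\<lambda>x. u n x - f x) g + l2inner f (\<lambda>x. v n x - g x)" for n
    using L by (simp add: l2inner_diff_left l2inner_diff_right L2_diff)
  then have "cmod (l2inner (u n) (v n) - l2inner f g) \<le> ?a n * ?b n + ?a n * l2norm g + l2norm f * ?b n" for n
    by (auto intro!: norm_triangle_le add_mono l2_Cauchy_Schwarz L2_diff L)
  moreover have "(\<lambda>n. ?a n * ?b n + ?a n * l2norm g + l2norm f * ?b n) \<longlonglongrightarrow> 0 * 0 + 0 * l2norm g + l2norm f * 0"
    by (intro tendsto_intros ab)
  ultimately have "(\<lambda>n. l2inner (u n) (v n) - l2inner f g) \<longlonglongrightarrow> 0"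
    by (metis (no_types, lifting) Lim_null_comparison always_eventually mult_zero_left mult_zero_right add_0)
  then show ?thesis by (simp add: LIM_zero_iff)
qed

lemma l2_tendsto_cong_AE:
  assumes "l2_tendsto u f" "g \<in> borel_measurable borel" "AE x in lborel. f x = g x"
  shows "l2_tendsto u g"
proof -
  note L = l2_tendsto_L2[OF assms(1)]
  note [measurable] = L[THEN L2_D(1)] assms(2)
  have "l2norm (\<lambda>x. u n x - f x) = l2norm (\<lambda>x. u n x - g x)" for n
    using assms(3) by (intro l2norm_cong_AE) auto
  then show ?thesis using assms(1) L2_cong_AE[OF L(2) assms(2,3)] by (simp add: l2_tendsto_def)
qed

lemma nn_integral_l2norm:
  assumes "f \<in> L2"
  shows "(\<integral>\<^sup>+x. ennreal ((cmod (f x))\<^sup>2) \<partial>lborel) = ennreal ((l2norm f)\<^sup>2)"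
  unfolding l2norm_power2 using nn_integral_eq_integral[OF L2_D(2)[OF assms]] by simp

lemma L2_nn_integralI:
  assumes "f \<in> borel_measurable borel" "(\<integral>\<^sup>+x. ennreal ((cmod (f x))\<^sup>2) \<partial>lborel) \<le> ennreal (C\<^sup>2)" "0 \<le> C"
  shows "f \<in> L2" "l2norm f \<le> C"
proof -
  note [measurable] = assms(1)
  have "integrable lborel (\<lambda>x. (cmod (f x))\<^sup>2)"
    using assms(2) by (intro integrableI_bounded) (auto simp: less_top[symmetric] top_unique)
  then show *: "f \<in> L2" using assms by (auto simp: L2_def)
  have "ennreal ((l2norm f)\<^sup>2) \<le> ennreal (C\<^sup>2)" using assms(2) nn_integral_l2norm[OF *] by simp
  then have "(l2norm f)\<^sup>2 \<le> C\<^sup>2" by simp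
  then show "l2norm f \<le> C" using assms(3) by (rule power2_le_imp_le)
qed

text \<open>Riesz--Fischer: along a subsequence with increments below \<open>3\<^sup>-\<^sup>n\<close>, the sum of
  \<open>4\<^sup>n\<close> times the squared increments has finite integral, so the subsequence converges almost
  everywhere; Fatou's lemma then gives convergence in the seminorm.\<close>

lemma l2_complete:
  fixes u :: "nat \<Rightarrow> 'a::euclidean_space \<Rightarrow> complex"
  assumes L: "\<And>n. u n \<in> L2"
    and C: "\<And>e. e > 0 \<Longrightarrow> \<exists>N. \<forall>m\<ge>N. \<forall>n\<ge>N. l2norm (\<lambda>x. u m x - u n x) < e"
  obtains f where "l2_tendsto u f"
proof -
  note [measurable] = L[THEN L2_D(1)]
  have "\<exists>r::nat\<Rightarrow>nat. strict_mono r \<and> (\<forall>n. \<forall>k\<ge>r n. l2norm (\<lambda>x. u k x - u (r n) x) < (1/3)^n)"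
  proof -
    have "\<exists>r::nat\<Rightarrow>nat. \<forall>n. (\<forall>k\<ge>r n. l2norm (\<lambda>x. u k x - u (r n) x) < (1/3)^n) \<and> r n < r (Suc n)"
    proof (rule dependent_nat_choice)
      show "\<exists>x. \<forall>k\<ge>x. l2norm (\<lambda>xa. u k xa - u x xa) < (1 / 3) ^ 0"
        using C[of 1] by fastforce
    next
      fix x n :: nat
      obtain N where N: "\<forall>m\<ge>N. \<forall>k\<ge>N. l2norm (\<lambda>x. u m x - u k x) < (1/3)^Suc n"
        using C[of "(1/3)^Suc n"] by auto
      show "\<exists>y. (\<forall>k\<ge>y. l2norm (\<lambda>xa. u k xa - u y xa) < (1 / 3) ^ Suc n) \<and> x < y"
        by (rule exI[of _ "max N (Suc x)"]) (use N in auto)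
    qed
    then show ?thesis by (auto simp: strict_mono_Suc_iff)
  qed
  then obtain r :: "nat \<Rightarrow> nat" where r: "strict_mono r"
    and rn: "\<And>n k. k \<ge> r n \<Longrightarrow> l2norm (\<lambda>x. u k x - u (r n) x) < (1/3)^n" by auto
  define d where "d n x = cmod (u (r (Suc n)) x - u (r n) x)" for n x
  have [measurable]: "d n \<in> borel_measurable borel" for n unfolding d_def by measurable
  have dn: "(\<integral>\<^sup>+x. ennreal (4^n * (d n x)\<^sup>2) \<partial>lborel) \<le> ennreal ((4/9)^n)" for n
  proof -
    have "(\<integral>\<^sup>+x. ennreal (4^n * (d n x)\<^sup>2) \<partial>lborel) = 4^n * (\<integral>\<^sup>+x. ennreal ((d n x)\<^sup>2) \<partial>lborel)"
      by (simp add: ennreal_mult nn_integral_cmult ennreal_power[symmetric] flip: ennreal_numeral)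
    also have "\<dots> = 4^n * ennreal ((l2norm (\<lambda>x. u (r (Suc n)) x - u (r n) x))\<^sup>2)"
      unfolding d_def by (simp add: nn_integral_l2norm L2_diff L)
    also have "\<dots> \<le> 4^n * ennreal (((1/3)^n)\<^sup>2)"
      using rn[of n "r (Suc n)"] r
      by (intro mult_left_mono ennreal_leI power_mono) (auto simp: strict_mono_less_eq intro: less_imp_le)
    also have "\<dots> = ennreal (4^n * ((1/3)^n)\<^sup>2)"
      by (simp add: ennreal_mult ennreal_power[symmetric] flip: ennreal_numeral)
    also have "4^n * ((1/3)^n)\<^sup>2 = (4/9 :: real)^n"
      by (simp add: power_mult_distrib[symmetric] power2_eq_square field_simps)
    finally show ?thesis .
  qed
  have "(\<integral>\<^sup>+x. (\<Sum>n. ennreal (4^n * (d n x)\<^sup>2)) \<partial>lborel) = (\<Sum>n. \<integral>\<^sup>+x. ennreal (4^n * (d n x)\<^sup>2) \<partial>lborel)"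
    by (intro nn_integral_suminf) measurable
  also have "\<dots> \<le> (\<Sum>n. ennreal ((4/9)^n))"
    by (intro suminf_le dn) auto
  also have "\<dots> < \<infinity>"
    by (subst suminf_ennreal2) auto
  finally have fin: "AE x in lborel. (\<Sum>n. ennreal (4^n * (d n x)\<^sup>2)) \<noteq> \<infinity>"
    by (intro nn_integral_PInf_AE) auto
  have conv: "AE x in lborel. convergent (\<lambda>n. u (r n) x)"
    using fin
  proof eventually_elim
    case (elim x)
    have s: "summable (\<lambda>n. 4^n * (d n x)\<^sup>2)"
      using elim by (intro summable_suminf_not_top) auto
    then obtain B where B: "\<And>n. norm (4^n * (d n x)\<^sup>2) \<le> B"
      using summable_imp_Bseq[OF s] by (auto simp: Bseq_def)
    have "d n x \<le> sqrt B * (1/2)^n" for n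
    proof -
      have "(2^n * d n x)\<^sup>2 \<le> B"
        using B[of n] by (simp add: power_mult_distrib power_mult[symmetric] mult.commute[of n 2] power_mult[of 2 2 n])
      then have "2^n * d n x \<le> sqrt B" by (rule real_le_rsqrt)
      then show ?thesis by (simp add: field_simps)
    qed
    moreover have "summable (\<lambda>n. sqrt B * (1/2)^n)" by (intro summable_mult summable_geometric) simp
    ultimately have "summable (\<lambda>n. u (r (Suc n)) x - u (r n) x)"
      unfolding d_def by (rule summable_comparison_test'[rotated])
    then have "(\<lambda>n. (\<Sum>k<n. u (r (Suc k)) x - u (r k) x)) \<longlonglongrightarrow> (\<Sum>k. u (r (Suc k)) x - u (r k) x)"
      by (rule summable_LIMSEQ)
    then have "(\<lambda>n. u (r n) x - u (r 0) x) \<longlonglongrightarrow> (\<Sum>k. u (r (Suc k)) x - u (r k) x)"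
      by (simp only: sum_lessThan_telescope[of "\<lambda>k. u (r k) x"])
    from tendsto_add[OF this tendsto_const[of "u (r 0) x"]] show ?case
      by (auto simp: convergent_def)
  qed
  define f where "f x = lim (\<lambda>n. u (r n) x)" for x
  have [measurable]: "f \<in> borel_measurable borel" unfolding f_def[abs_def] by measurable
  have lim: "AE x in lborel. (\<lambda>n. u (r n) x) \<longlonglongrightarrow> f x"
    using conv by eventually_elim (simp add: f_def convergent_LIMSEQ_iff)
  have bound: "(\<lambda>x. u m x - f x) \<in> L2 \<and> l2norm (\<lambda>x. u m x - f x) \<le> e"
    if m: "\<And>n. n \<ge> m \<Longrightarrow> l2norm (\<lambda>x. u m x - u n x) \<le> e" and "e \<ge> 0" for m e
  proof -
    have "(\<integral>\<^sup>+x. ennreal ((cmod (u m x - f x))\<^sup>2) \<partial>lborel) =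
       (\<integral>\<^sup>+x. liminf (\<lambda>n. ennreal ((cmod (u m x - u (r n) x))\<^sup>2)) \<partial>lborel)"
    proof (rule nn_integral_cong_AE)
      show "AE x in lborel. ennreal ((cmod (u m x - f x))\<^sup>2) = liminf (\<lambda>n. ennreal ((cmod (u m x - u (r n) x))\<^sup>2))"
        using lim
      proof eventually_elim
        case (elim x)
        have "(\<lambda>n. ennreal ((cmod (u m x - u (r n) x))\<^sup>2)) \<longlonglongrightarrow> ennreal ((cmod (u m x - f x))\<^sup>2)"
          by (intro tendsto_intros elim)
        then show ?case by (metis lim_imp_Liminf sequentially_bot)
      qed
    qed
    also have "\<dots> \<le> liminf (\<lambda>n. \<integral>\<^sup>+x. ennreal ((cmod (u m x - u (r n) x))\<^sup>2) \<partial>lborel)"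
      by (intro nn_integral_liminf) measurable
    also have "\<dots> = liminf (\<lambda>n. ennreal ((l2norm (\<lambda>x. u m x - u (r n) x))\<^sup>2))"
      by (simp add: nn_integral_l2norm L2_diff L)
    also have "\<dots> \<le> ennreal (e\<^sup>2)"
    proof (rule Liminf_le)
      show "\<forall>\<^sub>F n in sequentially. ennreal ((l2norm (\<lambda>x. u m x - u (r n) x))\<^sup>2) \<le> ennreal (e\<^sup>2)"
        using eventually_ge_at_top[of m]
      proof eventually_elim
        case (elim n)
        then have "r n \<ge> m" using seq_suble[OF r, of n] by simp
        then show ?case using m by (intro ennreal_leI power_mono) auto
      qed
    qed simp
    finally show ?thesis using \<open>e \<ge> 0\<close> by (auto intro: L2_nn_integralI[where C=e])
  qed
  have ev: "\<exists>N. \<forall>m\<ge>N. (\<lambda>x. u m x - f x) \<in> L2 \<and> l2norm (\<lambda>x. u m x - f x) \<le> e" if "e > 0" for e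
  proof -
    obtain N where N: "\<forall>m\<ge>N. \<forall>n\<ge>N. l2norm (\<lambda>x. u m x - u n x) < e" using C[OF \<open>e > 0\<close>] by auto
    show ?thesis
      by (intro exI[of _ N] allI impI bound) (use N \<open>e > 0\<close> in \<open>auto intro: less_imp_le\<close>)
  qed
  have fL: "f \<in> L2"
  proof -
    obtain N where "(\<lambda>x. u N x - f x) \<in> L2" using ev[of 1] by auto
    from L2_diff[OF L[of N] this] show ?thesis by simp
  qed
  have "l2_tendsto u f"
    unfolding l2_tendsto_def
  proof (intro conjI allI L fL LIMSEQ_I)
    fix e :: real assume "e > 0"
    then obtain N where "\<forall>m\<ge>N. l2norm (\<lambda>x. u m x - f x) \<le> e / 2" using ev[of "e/2"] by auto
    then show "\<exists>no. \<forall>n\<ge>no. norm (l2norm (\<lambda>x. u n x - f x) - 0) < e"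
      using \<open>e > 0\<close> by (intro exI[of _ N]) (fastforce simp: )
  qed
  then show ?thesis by (rule that)
qed


lemma lin_span_zero: "(\<lambda>x. 0) \<in> lin_span S"
  unfolding lin_span_def by (intro CollectI exI[of _ "{}"]) auto

lemma lin_span_scale:
  assumes "f \<in> lin_span S"
  shows "(\<lambda>x. c * f x) \<in> lin_span S"
proof -
  obtain T d where T: "finite T" "T \<subseteq> S" "f = (\<lambda>x. \<Sum>h\<in>T. d h * h x)" using assms by (auto simp: lin_span_def)
  then have "(\<lambda>x. c * f x) = (\<lambda>x. \<Sum>h\<in>T. (c * d h) * h x)" by (simp add: sum_distrib_left mult.assoc)
  then show ?thesis using T unfolding lin_span_def by (intro CollectI exI[of _ T] exI[of _ "\<lambda>h. c * d h"]) auto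
qed

lemma lin_span_add:
  assumes "f \<in> lin_span S" "g \<in> lin_span S"
  shows "(\<lambda>x. f x + g x) \<in> lin_span S"
proof -
  obtain T d where T: "finite T" "T \<subseteq> S" "f = (\<lambda>x. \<Sum>h\<in>T. d h * h x)" using assms by (auto simp: lin_span_def)
  obtain T' d' where T': "finite T'" "T' \<subseteq> S" "g = (\<lambda>x. \<Sum>h\<in>T'. d' h * h x)" using assms by (auto simp: lin_span_def)
  define e where "e h = (if h \<in> T then d h else 0) + (if h \<in> T' then d' h else 0)" for h
  have "f x = (\<Sum>h\<in>T \<union> T'. (if h \<in> T then d h else 0) * h x)" for x
    unfolding T(3) using T(1) T'(1) by (intro sum.mono_neutral_cong_left) auto
  moreover have "g x = (\<Sum>h\<in>T \<union> T'. (if h \<in> T' then d' h else 0) * h x)" for x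
    unfolding T'(3) using T(1) T'(1) by (intro sum.mono_neutral_cong_left) auto
  ultimately have "(\<lambda>x. f x + g x) = (\<lambda>x. \<Sum>h\<in>T \<union> T'. e h * h x)"
    by (simp add: e_def distrib_right sum.distrib)
  then show ?thesis using T T' unfolding lin_span_def by (intro CollectI exI[of _ "T \<union> T'"] exI[of _ e]) auto
qed

lemma lin_span_superset: "f \<in> S \<Longrightarrow> f \<in> lin_span S"
  unfolding lin_span_def by (intro CollectI exI[of _ "{f}"] exI[of _ "\<lambda>_. 1"]) auto

lemma lin_span_induct [consumes 1, case_names zero add]:
  assumes "f \<in> lin_span S" "P (\<lambda>x. 0)"
    "\<And>c s f. s \<in> S \<Longrightarrow> f \<in> lin_span S \<Longrightarrow> P f \<Longrightarrow> P (\<lambda>x. c * s x + f x)"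
  shows "P f"
proof -
  obtain T d where T: "finite T" "T \<subseteq> S" "f = (\<lambda>x. \<Sum>h\<in>T. d h * h x)" using assms(1) by (auto simp: lin_span_def)
  from T(1,2) have "P (\<lambda>x. \<Sum>h\<in>T. d h * h x)"
  proof (induction T)
    case (insert s T)
    have "(\<lambda>x. \<Sum>h\<in>T. d h * h x) \<in> lin_span S" using insert by (auto simp: lin_span_def)
    then show ?case using insert assms(3)[of s] by simp
  qed (use assms(2) in simp)
  then show ?thesis using T(3) by simp
qed

lemma closed_subspaceD:
  assumes "closed_subspace U"
  shows "U \<subseteq> L2" "(\<lambda>x. 0) \<in> U" "\<And>f g. f \<in> U \<Longrightarrow> g \<in> U \<Longrightarrow> (\<lambda>x. f x + g x) \<in> U"
    "\<And>c f. f \<in> U \<Longrightarrow> (\<lambda>x. c * f x) \<in> U" "\<And>u f. (\<And>n. u n \<in> U) \<Longrightarrow> l2_tendsto u f \<Longrightarrow> f \<in> U"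
  using assms unfolding closed_subspace_def by blast+

lemma closed_subspaceI:
  assumes "U \<subseteq> L2" "(\<lambda>x. 0) \<in> U" "\<And>f g. f \<in> U \<Longrightarrow> g \<in> U \<Longrightarrow> (\<lambda>x. f x + g x) \<in> U"
    "\<And>c f. f \<in> U \<Longrightarrow> (\<lambda>x. c * f x) \<in> U" "\<And>u f. (\<And>n. u n \<in> U) \<Longrightarrow> l2_tendsto u f \<Longrightarrow> f \<in> U"
  shows "closed_subspace U"
  using assms unfolding closed_subspace_def by blast

lemma closed_subspace_diff:
  assumes "closed_subspace U" "f \<in> U" "g \<in> U"
  shows "(\<lambda>x. f x - g x) \<in> U"
  using closed_subspaceD(3)[OF assms(1,2) closed_subspaceD(4)[OF assms(1,3), of "- 1"]] by simp

lemma closed_subspace_cong_AE: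
  assumes "closed_subspace U" "f \<in> U" "g \<in> borel_measurable borel" "AE x in lborel. f x = g x"
  shows "g \<in> U"
  using closed_subspaceD(5)[OF assms(1), of "\<lambda>_. f" g] assms closed_subspaceD(1)[OF assms(1)]
    l2_tendsto_cong_AE[OF l2_tendsto_const[of f] assms(3,4)] by auto

lemma lin_span_minimal:
  assumes "closed_subspace U" "S \<subseteq> U"
  shows "lin_span S \<subseteq> U"
proof
  fix f assume "f \<in> lin_span S"
  then show "f \<in> U"
  proof (induction rule: lin_span_induct)
    case (add c s f)
    then show ?case using assms by (intro closed_subspaceD(3,4)[OF assms(1)]) auto
  qed (rule closed_subspaceD(2)[OF assms(1)])
qed

lemma closed_subspace_L2: "closed_subspace L2"
  by (intro closed_subspaceI) (auto intro: L2_add L2_scale simp: l2_tendsto_def)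

lemma lin_span_L2: "S \<subseteq> L2 \<Longrightarrow> lin_span S \<subseteq> L2"
  by (intro lin_span_minimal closed_subspace_L2)

lemma closed_span_minimal:
  assumes "closed_subspace U" "S \<subseteq> U"
  shows "closed_span S \<subseteq> U"
  using lin_span_minimal[OF assms] closed_subspaceD(5)[OF assms(1)] unfolding closed_span_def by blast

lemma closed_span_superset:
  assumes "S \<subseteq> L2" "f \<in> S"
  shows "f \<in> closed_span S"
  unfolding closed_span_def using assms
  by (intro CollectI exI[of _ "\<lambda>_. f"]) (auto intro: l2_tendsto_const lin_span_superset)

lemma l2_tendsto_imp_Cauchy:
  assumes "l2_tendsto u f" "e > 0"
  shows "\<exists>N. \<forall>m\<ge>N. \<forall>n\<ge>N. l2norm (\<lambda>x. u m x - u n x) < e"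
proof -
  note L = l2_tendsto_L2[OF assms(1)]
  have "(\<lambda>n. l2norm (\<lambda>x. u n x - f x)) \<longlonglongrightarrow> 0" using assms by (auto simp: l2_tendsto_def)
  from LIMSEQ_D[OF this, of "e/2"] obtain N where N: "\<forall>n\<ge>N. l2norm (\<lambda>x. u n x - f x) < e / 2"
    using assms(2) by auto
  have "l2norm (\<lambda>x. u m x - u n x) < e" if "m \<ge> N" "n \<ge> N" for m n
  proof -
    have "l2norm (\<lambda>x. u m x - u n x) \<le> l2norm (\<lambda>x. u m x - f x) + l2norm (\<lambda>x. u n x - f x)"
      using l2norm_dist_triangle[OF L(1,2,1), of m n] by (simp add: l2norm_minus_commute[of f])
    also have "\<dots> < e / 2 + e / 2" by (intro add_strict_mono) (use N that in auto)
    finally show ?thesis by simp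
  qed
  then show ?thesis by blast
qed

lemma closed_subspace_closed_span:
  assumes "S \<subseteq> L2"
  shows "closed_subspace (closed_span S)"
proof (rule closed_subspaceI)
  show "closed_span S \<subseteq> L2" by (auto simp: closed_span_def l2_tendsto_def)
  show "(\<lambda>x. 0) \<in> closed_span S"
    unfolding closed_span_def by (intro CollectI exI[of _ "\<lambda>_ _. 0"]) (auto intro: lin_span_zero l2_tendsto_const)
  show "(\<lambda>x. f x + g x) \<in> closed_span S" if "f \<in> closed_span S" "g \<in> closed_span S" for f g
  proof -
    obtain u where u: "\<And>n. u n \<in> lin_span S" "l2_tendsto u f"
      using \<open>f \<in> closed_span S\<close> unfolding closed_span_def by auto
    obtain v where v: "\<And>n. v n \<in> lin_span S" "l2_tendsto v g"
      using \<open>g \<in> closed_span S\<close> unfolding closed_span_def by auto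
    note uv = u v
    show ?thesis using uv unfolding closed_span_def
      by (intro CollectI exI[of _ "\<lambda>n x. u n x + v n x"]) (auto intro: lin_span_add l2_tendsto_add)
  qed
  show "(\<lambda>x. c * f x) \<in> closed_span S" if "f \<in> closed_span S" for f c
  proof -
    obtain u where u: "\<And>n. u n \<in> lin_span S" "l2_tendsto u f"
      using \<open>f \<in> closed_span S\<close> unfolding closed_span_def by auto
    show ?thesis using u unfolding closed_span_def
      by (intro CollectI exI[of _ "\<lambda>n x. c * u n x"]) (auto intro: lin_span_scale l2_tendsto_scale)
  qed
next
  fix u f assume u: "\<And>n. u n \<in> closed_span S" "l2_tendsto u f"
  note L = l2_tendsto_L2[OF u(2)]
  have "\<exists>v\<in>lin_span S. l2norm (\<lambda>x. v x - u n x) < 1 / Suc n" for n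
  proof -
    obtain v where v: "\<And>k. v k \<in> lin_span S" "l2_tendsto v (u n)"
      using u(1)[of n] by (auto simp: closed_span_def)
    then have "(\<lambda>k. l2norm (\<lambda>x. v k x - u n x)) \<longlonglongrightarrow> 0" by (auto simp: l2_tendsto_def)
    from LIMSEQ_D[OF this, of "1 / Suc n"] show ?thesis using v(1) by force
  qed
  then obtain v where v: "\<And>n. v n \<in> lin_span S" "\<And>n. l2norm (\<lambda>x. v n x - u n x) < 1 / Suc n" by metis
  have vL: "v n \<in> L2" for n using v(1) lin_span_L2[OF assms] by auto
  have "l2_tendsto v f"
  proof (rule l2_tendstoI[where C="\<lambda>n. 1 / Suc n + l2norm (\<lambda>x. u n x - f x)"])
    show "l2norm (\<lambda>x. v n x - f x) \<le> 1 / Suc n + l2norm (\<lambda>x. u n x - f x)" for n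
      using l2norm_dist_triangle[OF vL L, of n n] v(2)[of n] by linarith
    have "(\<lambda>n. 1 / Suc n + l2norm (\<lambda>x. u n x - f x)) \<longlonglongrightarrow> 0 + 0"
      using u(2) by (intro tendsto_add LIMSEQ_Suc lim_1_over_n) (auto simp: l2_tendsto_def)
    then show "(\<lambda>n. 1 / Suc n + l2norm (\<lambda>x. u n x - f x)) \<longlonglongrightarrow> 0" by simp
  qed (use vL L in auto)
  then show "f \<in> closed_span S" using v(1) by (auto simp: closed_span_def)
qed

lemma l2_parallelogram:
  assumes "f \<in> L2" "g \<in> L2"
  shows "(l2norm (\<lambda>x. f x + g x))\<^sup>2 + (l2norm (\<lambda>x. f x - g x))\<^sup>2 = 2 * (l2norm f)\<^sup>2 + 2 * (l2norm g)\<^sup>2"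
  using l2norm_diff_power2[OF assms, of 1] l2norm_diff_power2[OF assms, of "- 1"] by simp

lemma orthogonal_projection:
  assumes U: "closed_subspace U" and f: "f \<in> L2"
  obtains p where "p \<in> U" "\<And>g. g \<in> U \<Longrightarrow> l2inner (\<lambda>x. f x - p x) g = 0"
proof -
  have UL: "g \<in> L2" if "g \<in> U" for g using that closed_subspaceD(1)[OF U] by auto
  define d where "d = (INF g\<in>U. l2norm (\<lambda>x. f x - g x))"
  have bdd: "bdd_below ((\<lambda>g. l2norm (\<lambda>x. f x - g x)) ` U)" by (rule bdd_belowI[of _ 0]) auto
  have d_le: "d \<le> l2norm (\<lambda>x. f x - g x)" if "g \<in> U" for g
    unfolding d_def using bdd that by (intro cINF_lower) auto
  have d0: "0 \<le> d" unfolding d_def using closed_subspaceD(2)[OF U] by (intro cINF_greatest) auto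
  have "\<exists>g\<in>U. l2norm (\<lambda>x. f x - g x) < d + 1 / Suc n" for n
    using cINF_less_iff[OF _ bdd, of "d + 1 / Suc n"] closed_subspaceD(2)[OF U] unfolding d_def by auto
  then obtain u where u: "\<And>n. u n \<in> U" "\<And>n. l2norm (\<lambda>x. f x - u n x) < d + 1 / Suc n" by metis
  have est: "(l2norm (\<lambda>x. u m x - u n x))\<^sup>2 \<le> 2 * (d + 1 / Suc m)\<^sup>2 + 2 * (d + 1 / Suc n)\<^sup>2 - 4 * d\<^sup>2" for m n
  proof -
    let ?a = "\<lambda>x. f x - u n x" and ?b = "\<lambda>x. f x - u m x"
    have mid: "(\<lambda>x. (1/2) * (u n x + u m x)) \<in> U" by (intro closed_subspaceD(3,4)[OF U] u)
    have "(l2norm (\<lambda>x. ?a x + ?b x))\<^sup>2 = (2 * l2norm (\<lambda>x. f x - (1/2) * (u n x + u m x)))\<^sup>2"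
      using l2norm_scale[of 2 "\<lambda>x. f x - (1/2) * (u n x + u m x)"] by (simp add: algebra_simps)
    also have "\<dots> \<ge> (2 * d)\<^sup>2" using d0 d_le[OF mid] by (intro power_mono) auto
    finally have "(2 * d)\<^sup>2 \<le> (l2norm (\<lambda>x. ?a x + ?b x))\<^sup>2" .
    moreover have "(l2norm ?a)\<^sup>2 \<le> (d + 1 / Suc n)\<^sup>2" "(l2norm ?b)\<^sup>2 \<le> (d + 1 / Suc m)\<^sup>2"
      by (intro power_mono less_imp_le[OF u(2)] l2norm_nonneg)+
    moreover have "(l2norm (\<lambda>x. ?a x + ?b x))\<^sup>2 + (l2norm (\<lambda>x. ?a x - ?b x))\<^sup>2 = 2 * (l2norm ?a)\<^sup>2 + 2 * (l2norm ?b)\<^sup>2"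
      by (intro l2_parallelogram L2_diff f UL u)
    ultimately show ?thesis by (simp add: power_mult_distrib)
  qed
  have "\<exists>N. \<forall>m\<ge>N. \<forall>n\<ge>N. l2norm (\<lambda>x. u m x - u n x) < e" if "e > 0" for e
  proof -
    have "(\<lambda>n. 4 * (d + 1 / Suc n)\<^sup>2 - 4 * d\<^sup>2) \<longlonglongrightarrow> 4 * (d + 0)\<^sup>2 - 4 * d\<^sup>2"
      by (intro tendsto_intros LIMSEQ_Suc lim_1_over_n)
    then have "(\<lambda>n. 4 * (d + 1 / Suc n)\<^sup>2 - 4 * d\<^sup>2) \<longlonglongrightarrow> 0" by simp
    then have "eventually (\<lambda>n. 4 * (d + 1 / Suc n)\<^sup>2 - 4 * d\<^sup>2 < e\<^sup>2) sequentially"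
      using that by (intro order_tendstoD(2)) auto
    then obtain N where N: "4 * (d + 1 / Suc N)\<^sup>2 - 4 * d\<^sup>2 < e\<^sup>2"
      by (auto simp: eventually_sequentially)
    have "l2norm (\<lambda>x. u m x - u n x) < e" if "m \<ge> N" "n \<ge> N" for m n
    proof (rule power2_less_imp_less)
      have "(d + 1 / Suc k)\<^sup>2 \<le> (d + 1 / Suc N)\<^sup>2" if "k \<ge> N" for k
        using d0 that by (intro power_mono add_left_mono divide_left_mono) auto
      from this[OF \<open>m \<ge> N\<close>] this[OF \<open>n \<ge> N\<close>] show "(l2norm (\<lambda>x. u m x - u n x))\<^sup>2 < e\<^sup>2"
        using est[of m n] N by linarith
    qed (use \<open>e > 0\<close> in simp)
    then show ?thesis by blast
  qed
  then obtain p where p: "l2_tendsto u p"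
    using l2_complete[of u] UL u(1) by blast
  have pU: "p \<in> U" using closed_subspaceD(5)[OF U u(1) p] .
  have "l2norm (\<lambda>x. f x - p x) \<le> d"
  proof (rule tendsto_le[OF _ _ tendsto_const])
    have "(\<lambda>n. (d + 1 / Suc n) + l2norm (\<lambda>x. u n x - p x)) \<longlonglongrightarrow> (d + 0) + 0"
      using p by (intro tendsto_intros LIMSEQ_Suc lim_1_over_n) (auto simp: l2_tendsto_def)
    then show "(\<lambda>n. (d + 1 / Suc n) + l2norm (\<lambda>x. u n x - p x)) \<longlonglongrightarrow> d" by simp
    show "\<forall>\<^sub>F n in sequentially. l2norm (\<lambda>x. f x - p x) \<le> (d + 1 / Suc n) + l2norm (\<lambda>x. u n x - p x)"
      using l2norm_dist_triangle[OF f UL[OF u(1)] UL[OF pU]] u(2)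
      by (intro always_eventually allI) (meson add_right_mono less_imp_le order_trans)
  qed simp
  then have pd: "(l2norm (\<lambda>x. f x - p x))\<^sup>2 \<le> d\<^sup>2" by (intro power_mono) auto
  have "l2inner (\<lambda>x. f x - p x) g = 0" if g: "g \<in> U" for g
  proof (rule ccontr)
    define z where "z = l2inner (\<lambda>x. f x - p x) g"
    assume "l2inner (\<lambda>x. f x - p x) g \<noteq> 0"
    then have z: "z \<noteq> 0" by (simp add: z_def)
    have key: "2 * t \<le> t\<^sup>2 * (l2norm g)\<^sup>2" for t :: real
    proof -
      have "(\<lambda>x. p x + of_real t * z * g x) \<in> U" by (intro closed_subspaceD(3,4)[OF U] pU g)
      from d_le[OF this] d0 have "d\<^sup>2 \<le> (l2norm (\<lambda>x. f x - (p x + of_real t * z * g x)))\<^sup>2"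
        by (intro power_mono)
      also have "(\<lambda>x. f x - (p x + of_real t * z * g x)) = (\<lambda>x. (f x - p x) - (of_real t * z) * g x)"
        by (simp add: algebra_simps)
      also have "(l2norm \<dots>)\<^sup>2 = (l2norm (\<lambda>x. f x - p x))\<^sup>2 - 2 * Re (cnj (of_real t * z) * z)
           + (cmod (of_real t * z))\<^sup>2 * (l2norm g)\<^sup>2"
        unfolding z_def by (intro l2norm_diff_power2 L2_diff f UL pU g)
      also have "cnj (of_real t * z) * z = of_real (t * (cmod z)\<^sup>2)"
        unfolding of_real_mult complex_norm_square by simp
      finally have "2 * t * (cmod z)\<^sup>2 \<le> t\<^sup>2 * (l2norm g)\<^sup>2 * (cmod z)\<^sup>2"
        using pd by (simp add: norm_mult power_mult_distrib mult_ac)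
      then show ?thesis using z by (simp add: mult_le_cancel_right)
    qed
    define c where "c = (l2norm g)\<^sup>2"
    have "c \<ge> 0" by (simp add: c_def)
    have "2 * (1 / (c + 1)) \<le> (1 / (c + 1))\<^sup>2 * c" using key c_def by blast
    then have "2 * (c + 1) \<le> c" using \<open>c \<ge> 0\<close> by (simp add: divide_simps power2_eq_square split: if_splits)
    then show False using \<open>c \<ge> 0\<close> by simp
  qed
  then show ?thesis using that pU by blast
qed

lemma closed_span_eqI:
  assumes U: "closed_subspace U" and S: "S \<subseteq> U"
    and total: "\<And>f. f \<in> U \<Longrightarrow> (\<And>s. s \<in> S \<Longrightarrow> l2inner f s = 0) \<Longrightarrow> AE x in lborel. f x = 0"
  shows "closed_span S = U"
proof
  show "closed_span S \<subseteq> U" by (rule closed_span_minimal[OF U S])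
  have SL: "S \<subseteq> L2" using S closed_subspaceD(1)[OF U] by auto
  note C = closed_subspace_closed_span[OF SL]
  show "U \<subseteq> closed_span S"
  proof
    fix f assume f: "f \<in> U"
    then have fL: "f \<in> L2" using closed_subspaceD(1)[OF U] by auto
    obtain p where p: "p \<in> closed_span S" "\<And>g. g \<in> closed_span S \<Longrightarrow> l2inner (\<lambda>x. f x - p x) g = 0"
      using orthogonal_projection[OF C fL] by blast
    have "AE x in lborel. f x - p x = 0"
      using f p closed_span_minimal[OF U S] closed_span_superset[OF SL]
      by (intro total closed_subspace_diff[OF U]) auto
    then have "AE x in lborel. p x = f x" by eventually_elim simp
    then show "f \<in> closed_span S"
      by (rule closed_subspace_cong_AE[OF C p(1) L2_D(1)[OF fL]])
  qed
qed

lemma closed_subspace_orthogonal: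
  assumes "g \<in> L2"
  shows "closed_subspace {f \<in> L2. l2inner f g = 0}"
proof (rule closed_subspaceI)
  fix u f assume u: "\<And>n. u n \<in> {f \<in> L2. l2inner f g = 0}" "l2_tendsto u f"
  from l2_tendsto_inner[OF u(2) l2_tendsto_const[OF assms]] u(1)
  have "l2inner f g = 0" by (simp add: LIMSEQ_const_iff)
  then show "f \<in> {f \<in> L2. l2inner f g = 0}" using l2_tendsto_L2[OF u(2)] by simp
qed (use assms in \<open>auto intro: L2_add L2_scale simp: l2inner_add_left l2inner_scale_left\<close>)

lemma closed_span_orthogonal:
  assumes "S \<subseteq> L2" "T \<subseteq> L2" "\<And>s t. s \<in> S \<Longrightarrow> t \<in> T \<Longrightarrow> l2inner s t = 0"
    and "f \<in> closed_span S" "g \<in> closed_span T"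
  shows "l2inner f g = 0"
proof -
  have 1: "l2inner f t = 0" if "t \<in> T" for t
    using closed_span_minimal[OF closed_subspace_orthogonal[of t], of S] assms that by auto
  have "f \<in> L2" "g \<in> L2"
    using assms closed_span_minimal[OF closed_subspace_L2] by blast+
  then have "l2inner g f = 0"
    using closed_span_minimal[OF closed_subspace_orthogonal[of f], of T] assms(2,5) 1
      l2inner_commute[of f] by auto
  then show ?thesis using l2inner_commute[of f g] by simp
qed

text \<open>Stated for relations, so that it applies both to operators and to the Fourier
  transform, which is determined only up to null sets.\<close>

lemma closed_subspace_preimage:
  assumes U: "closed_subspace U"
    and L: "\<And>f g. R f g \<Longrightarrow> f \<in> L2 \<and> g \<in> L2"
    and total: "\<And>f. f \<in> L2 \<Longrightarrow> \<exists>g. R f g"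
    and add: "\<And>f g f' g'. R f g \<Longrightarrow> R f' g' \<Longrightarrow> R (\<lambda>x. f x + f' x) (\<lambda>x. g x + g' x)"
    and scale: "\<And>c f g. R f g \<Longrightarrow> R (\<lambda>x. c * f x) (\<lambda>x. c * g x)"
    and bounded: "\<And>f g. R f g \<Longrightarrow> l2norm g \<le> C * l2norm f"
  shows "closed_subspace {f. \<exists>g\<in>U. R f g}"
proof (rule closed_subspaceI)
  show "{f. \<exists>g\<in>U. R f g} \<subseteq> L2" using L by auto
  obtain g where "R (\<lambda>x. 0) g" using total[of "\<lambda>x. 0"] by auto
  from scale[OF this, of 0] have "R (\<lambda>x. 0) (\<lambda>x. 0)" by simp
  then show "(\<lambda>x. 0) \<in> {f. \<exists>g\<in>U. R f g}" using closed_subspaceD(2)[OF U] by auto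
  show "(\<lambda>x. f x + f' x) \<in> {f. \<exists>g\<in>U. R f g}" if "f \<in> {f. \<exists>g\<in>U. R f g}" "f' \<in> {f. \<exists>g\<in>U. R f g}" for f f'
    using that add closed_subspaceD(3)[OF U] by fast
  show "(\<lambda>x. c * f x) \<in> {f. \<exists>g\<in>U. R f g}" if "f \<in> {f. \<exists>g\<in>U. R f g}" for c f
    using that scale closed_subspaceD(4)[OF U] by fast
next
  fix u f assume u: "\<And>n. u n \<in> {f. \<exists>g\<in>U. R f g}" "l2_tendsto u f"
  then obtain v where v: "\<And>n. v n \<in> U" "\<And>n. R (u n) (v n)" by simp metis
  note fL = l2_tendsto_L2[OF u(2)]
  obtain g where g: "R f g" using total[OF fL(2)] by auto
  have "l2_tendsto v g"
  proof (rule l2_tendstoI)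
    show "v n \<in> L2" "g \<in> L2" for n using L v(2) g by blast+
    have "R (\<lambda>x. u n x - f x) (\<lambda>x. v n x - g x)" for n
      using add[OF v(2) scale[OF g, of "- 1"], of n] by simp
    then show "l2norm (\<lambda>x. v n x - g x) \<le> C * l2norm (\<lambda>x. u n x - f x)" for n using bounded by simp
    show "(\<lambda>n. C * l2norm (\<lambda>x. u n x - f x)) \<longlonglongrightarrow> 0"
      using u(2) by (intro tendsto_mult_right_zero) (auto simp: l2_tendsto_def)
  qed
  then show "f \<in> {f. \<exists>g\<in>U. R f g}" using closed_subspaceD(5)[OF U v(1)] g by auto
qed

lemma closed_span_image:
  assumes S: "S \<subseteq> L2" and U: "closed_subspace U"
    and T: "\<And>s. s \<in> S \<Longrightarrow> T s \<in> U" "\<And>f. f \<in> L2 \<Longrightarrow> T f \<in> L2"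
    and add: "\<And>f g. f \<in> L2 \<Longrightarrow> g \<in> L2 \<Longrightarrow> T (\<lambda>x. f x + g x) = (\<lambda>x. T f x + T g x)"
    and scale: "\<And>c f. f \<in> L2 \<Longrightarrow> T (\<lambda>x. c * f x) = (\<lambda>x. c * T f x)"
    and bounded: "\<And>f. f \<in> L2 \<Longrightarrow> l2norm (T f) \<le> C * l2norm f"
    and f: "f \<in> closed_span S"
  shows "T f \<in> U"
proof -
  define R where "R f g \<longleftrightarrow> f \<in> L2 \<and> g = T f" for f g
  have "closed_subspace {f. \<exists>g\<in>U. R f g}"
    by (rule closed_subspace_preimage[OF U, where C=C]) (auto simp: R_def T add scale bounded L2_add L2_scale)
  moreover have "S \<subseteq> {f. \<exists>g\<in>U. R f g}" using S T by (auto simp: R_def)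
  ultimately have "closed_span S \<subseteq> {f. \<exists>g\<in>U. R f g}" by (rule closed_span_minimal)
  then show ?thesis using f by (auto simp: R_def)
qed

lemma closed_span_mono: "S \<subseteq> T \<Longrightarrow> T \<subseteq> L2 \<Longrightarrow> closed_span S \<subseteq> closed_span T"
  using closed_span_minimal[OF closed_subspace_closed_span] closed_span_superset by blast

lemma closed_span_Un_decompose:
  assumes S: "S \<subseteq> L2" and T: "T \<subseteq> L2" and orth: "\<And>s t. s \<in> S \<Longrightarrow> t \<in> T \<Longrightarrow> l2inner s t = 0"
    and f: "f \<in> closed_span (S \<union> T)"
  obtains p where "p \<in> closed_span S" "(\<lambda>x. f x - p x) \<in> closed_span T"
proof -
  have ST: "S \<union> T \<subseteq> L2" using S T by simp
  note CS = closed_subspace_closed_span[OF S] and CT = closed_subspace_closed_span[OF T]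
    and CST = closed_subspace_closed_span[OF ST]
  note sub = closed_span_mono[OF Un_upper1 ST] closed_span_mono[OF Un_upper2 ST]
  have fL: "f \<in> L2" using f closed_subspaceD(1)[OF CST] by blast
  obtain p where p: "p \<in> closed_span S" "\<And>g. g \<in> closed_span S \<Longrightarrow> l2inner (\<lambda>x. f x - p x) g = 0"
    using orthogonal_projection[OF CS fL] by blast
  define g where "g x = f x - p x" for x
  have pL: "p \<in> L2" using p(1) closed_subspaceD(1)[OF CS] by blast
  have g: "g \<in> closed_span (S \<union> T)" unfolding g_def[abs_def]
    by (rule closed_subspace_diff[OF CST f]) (use p(1) sub in blast)
  have gL: "g \<in> L2" using g closed_subspaceD(1)[OF CST] by blast
  obtain q where q: "q \<in> closed_span T" "\<And>h. h \<in> closed_span T \<Longrightarrow> l2inner (\<lambda>x. g x - q x) h = 0"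
    using orthogonal_projection[OF CT gL] by blast
  have qL: "q \<in> L2" using q(1) closed_subspaceD(1)[OF CT] by blast
  define r where "r x = g x - q x" for x
  have r: "r \<in> closed_span (S \<union> T)" unfolding r_def[abs_def]
    by (rule closed_subspace_diff[OF CST g]) (use q(1) sub in blast)
  have rL: "r \<in> L2" using r closed_subspaceD(1)[OF CST] by blast
  have "l2inner r s = 0" if "s \<in> S \<union> T" for s
  proof (cases "s \<in> T")
    case True
    then show ?thesis using q(2) closed_span_superset[OF T] unfolding r_def[abs_def] by blast
  next
    case False
    then have s: "s \<in> S" using that by simp
    have "l2inner s q = 0"
      by (rule closed_span_orthogonal[OF S T orth]) (use closed_span_superset[OF S s] q in auto)
    then have "l2inner q s = 0" by (subst l2inner_commute) simp
    moreover have "l2inner g s = 0"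
      using p(2) closed_span_superset[OF S s] unfolding g_def[abs_def] by blast
    moreover have "s \<in> L2" using s S by blast
    ultimately show ?thesis unfolding r_def[abs_def] by (simp add: l2inner_diff_left gL qL)
  qed
  then have "l2inner r r = 0"
    using closed_span_orthogonal[of "{r}" "S \<union> T" r r] rL ST r closed_span_superset[of "{r}" r] by auto
  then have "AE x in lborel. r x = 0"
    unfolding l2inner_self using l2norm_eq_0_iff[OF rL] by simp
  then have "AE x in lborel. q x = g x" by eventually_elim (simp add: r_def)
  then have "g \<in> closed_span T"
    by (rule closed_subspace_cong_AE[OF CT q(1) L2_D(1)[OF gL]])
  then show ?thesis using that p(1) unfolding g_def[abs_def] by blast
qed

lemma tight_frame_total:
  assumes "tight_frame a L2 I e" "a > 0"
  shows "closed_span (e ` I) = L2"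
proof (rule closed_span_eqI[OF closed_subspace_L2])
  show "e ` I \<subseteq> L2" using assms by (auto simp: tight_frame_def)
  fix f :: "'a \<Rightarrow> complex" assume f: "f \<in> L2" "\<And>s. s \<in> e ` I \<Longrightarrow> l2inner f s = 0"
  have "((\<lambda>i. (cmod (l2inner f (e i)))\<^sup>2) has_sum a * (l2norm f)\<^sup>2) I"
    using assms f(1) by (simp add: tight_frame_def)
  moreover have "((\<lambda>i. (cmod (l2inner f (e i)))\<^sup>2) has_sum 0) I"
    using f(2) by (intro has_sum_0) auto
  ultimately have "a * (l2norm f)\<^sup>2 = 0" by (rule has_sum_unique)
  then show "AE x in lborel. f x = 0" using assms(2) l2norm_eq_0_iff[OF f(1)] by simp
qed

section \<open>The Fourier integral of a Gaussian\<close>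

lemma borel_measurable_cis [measurable (raw)]:
  "f \<in> borel_measurable M \<Longrightarrow> (\<lambda>x. cis (f x)) \<in> borel_measurable M"
  by (rule borel_measurable_continuous_on[OF _, of cis]) (auto intro: continuous_intros)

lemma integral_lborel_shift:
  fixes f :: "'a::euclidean_space \<Rightarrow> 'b::{banach, second_countable_topology}"
  assumes [measurable]: "f \<in> borel_measurable borel"
  shows "(LINT x|lborel. f (c + x)) = integral\<^sup>L lborel f"
  by (subst (2) lborel_distr_plus[symmetric, of c]) (simp add: integral_distr)

lemma integrable_lborel_shift:
  fixes f :: "'a::euclidean_space \<Rightarrow> 'b::{banach, second_countable_topology}"
  assumes [measurable]: "f \<in> borel_measurable borel"
  shows "integrable lborel (\<lambda>x. f (c + x)) \<longleftrightarrow> integrable lborel f"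
  by (subst (2) lborel_distr_plus[symmetric, of c]) (simp add: integrable_distr_eq)

lemma integral_lborel_affine:
  fixes f :: "'a::euclidean_space \<Rightarrow> complex"
  assumes [measurable]: "f \<in> borel_measurable borel" and "c \<noteq> 0"
  shows "integral\<^sup>L lborel f = \<bar>c\<bar> ^ DIM('a) *\<^sub>R (LINT x|lborel. f (t + c *\<^sub>R x))"
  by (subst lborel_affine[OF assms(2), of t])
     (simp add: integral_density integral_distr)

lemma integrable_lborel_affine:
  fixes f :: "'a::euclidean_space \<Rightarrow> complex"
  assumes f: "integrable lborel f" and "c \<noteq> 0"
  shows "integrable lborel (\<lambda>x. f (t + c *\<^sub>R x))"
proof -
  note [measurable] = borel_measurable_integrable[OF f, simplified]
  have "integrable (density (distr lborel borel (\<lambda>x. t + c *\<^sub>R x)) (\<lambda>_. ennreal (\<bar>c\<bar>^DIM('a)))) f"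
    using f lborel_affine[OF assms(2), of t] by (simp add: ennreal_power)
  then have "integrable lborel (\<lambda>x. \<bar>c\<bar>^DIM('a) *\<^sub>R f (t + c *\<^sub>R x))"
    by (simp add: integrable_density integrable_distr_eq)
  from integrable_scaleR_right[OF this, of "inverse (\<bar>c\<bar>^DIM('a))"] show ?thesis
    using assms(2) by simp
qed

definition gauss :: "'a::euclidean_space \<Rightarrow> real" where
  "gauss x = exp (- pi * (norm x)\<^sup>2)"

lemma gauss_pos: "0 < gauss x" and gauss_le_1: "gauss x \<le> 1" and gauss_minus: "gauss (- x) = gauss x"
  by (simp_all add: gauss_def)

lemma borel_measurable_gauss [measurable]: "gauss \<in> borel_measurable borel"
  unfolding gauss_def[abs_def] by measurable

lemma gauss_real_fourier:
  "(LINT x|lborel. of_real (exp (- pi * x\<^sup>2)) * cis (- 2 * pi * (x * \<xi>))) = complex_of_real (exp (- pi * \<xi>\<^sup>2))"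
proof -
  define c where "c = sqrt (2 * pi)"
  have c: "c > 0" "c * c = 2 * pi" "c\<^sup>2 = 2 * pi" by (simp_all add: c_def)
  have "complex_of_real (exp (- ((- c * \<xi>)\<^sup>2) / 2)) = char std_normal_distribution (- c * \<xi>)"
    by (simp add: char_std_normal_distribution)
  also have "\<dots> = (LINT x|lborel. std_normal_density x *\<^sub>R cis ((- c * \<xi>) * x))"
    unfolding char_def by (subst integral_density) (auto simp: normal_density_nonneg cis_conv_exp)
  also have "\<dots> = \<bar>c\<bar> *\<^sub>R (LINT x|lborel. std_normal_density (0 + c * x) *\<^sub>R cis ((- c * \<xi>) * (0 + c * x)))"
    using c by (intro lborel_integral_real_affine) simp
  also have "\<dots> = (LINT x|lborel. \<bar>c\<bar> *\<^sub>R (std_normal_density (0 + c * x) *\<^sub>R cis ((- c * \<xi>) * (0 + c * x))))"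
    by (rule integral_scaleR_right[symmetric])
  also have "\<dots> = (LINT x|lborel. of_real (exp (- pi * x\<^sup>2)) * cis (- 2 * pi * (x * \<xi>)))"
  proof (rule Bochner_Integration.integral_cong[OF refl])
    fix x
    have "c * std_normal_density (c * x) = exp (- pi * x\<^sup>2)"
      using c by (simp add: std_normal_density_def power_mult_distrib c_def[symmetric])
    moreover have "(- c * \<xi>) * (0 + c * x) = - 2 * pi * (x * \<xi>)"
    proof -
      have "(- c * \<xi>) * (0 + c * x) = - (c * c) * (x * \<xi>)" by (simp add: mult_ac)
      then show ?thesis by (simp add: c(2))
    qed
    moreover have "\<bar>c\<bar> *\<^sub>R (std_normal_density (0 + c * x) *\<^sub>R z) = of_real (c * std_normal_density (c * x)) * z" for z :: complex
      using c by (simp add: scaleR_conv_of_real)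
    ultimately show "\<bar>c\<bar> *\<^sub>R (std_normal_density (0 + c * x) *\<^sub>R cis ((- c * \<xi>) * (0 + c * x))) =
        of_real (exp (- pi * x\<^sup>2)) * cis (- 2 * pi * (x * \<xi>))"
      by (simp only:)
  qed
  finally show ?thesis using c by (simp add: power_mult_distrib)
qed

lemma integrable_real_gauss: "integrable lborel (\<lambda>x::real. complex_of_real (exp (- pi * x\<^sup>2)))"
  using gauss_real_fourier[of 0] not_integrable_integral_eq by fastforce

lemma integral_lborel_prod:
  fixes f :: "'a::euclidean_space \<Rightarrow> real \<Rightarrow> complex"
  assumes f: "\<And>b. b \<in> Basis \<Longrightarrow> integrable lborel (f b)"
  shows "(LINT x|lborel. (\<Prod>b\<in>Basis. f b (x \<bullet> b))) = (\<Prod>b\<in>Basis. integral\<^sup>L lborel (f b))"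
    and "integrable lborel (\<lambda>x::'a. (\<Prod>b\<in>Basis. f b (x \<bullet> b)))"
proof -
  interpret product_sigma_finite "\<lambda>_::'a. lborel :: real measure" ..
  have [measurable]: "f b \<in> borel_measurable borel" if "b \<in> Basis" for b
    using f[OF that] by (auto dest: borel_measurable_integrable)
  have m: "(\<lambda>x::'a. (\<Prod>b\<in>Basis. f b (x \<bullet> b))) \<in> borel_measurable borel" by measurable
  have T: "(\<lambda>g. \<Sum>b\<in>Basis. g b *\<^sub>R b) \<in> Pi\<^sub>M (Basis :: 'a set) (\<lambda>_. lborel :: real measure) \<rightarrow>\<^sub>M borel" by measurable
  have eq: "(\<Prod>b\<in>Basis. f b ((\<Sum>b\<in>Basis. g b *\<^sub>R b) \<bullet> b)) = (\<Prod>b\<in>Basis. f b (g b))" for g :: "'a \<Rightarrow> real"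
    by (intro prod.cong refl) (simp add: inner_sum_left_Basis)
  show "(LINT x|lborel. (\<Prod>b\<in>Basis. f b (x \<bullet> b))) = (\<Prod>b\<in>Basis. integral\<^sup>L lborel (f b))"
    by (subst lborel_eq, subst integral_distr[OF T m]) (simp add: eq product_integral_prod f)
  show "integrable lborel (\<lambda>x::'a. (\<Prod>b\<in>Basis. f b (x \<bullet> b)))"
    by (subst lborel_eq, subst integrable_distr_eq[OF T m]) (simp add: eq product_integrable_prod f)
qed

lemma gauss_prod: "complex_of_real (gauss x) = (\<Prod>b\<in>Basis. of_real (exp (- pi * (x \<bullet> b)\<^sup>2)))"
proof -
  have "(norm x)\<^sup>2 = (\<Sum>b\<in>Basis. (x \<bullet> b)\<^sup>2)"
    unfolding power2_norm_eq_inner by (subst euclidean_inner) (simp add: power2_eq_square)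
  then show ?thesis by (simp add: gauss_def sum_distrib_left exp_sum flip: sum_negf)
qed

lemma cis_sum: "finite A \<Longrightarrow> cis (\<Sum>i\<in>A. f i) = (\<Prod>i\<in>A. cis (f i))"
  by (induction A rule: finite_induct) (simp_all flip: cis_mult)

lemma integrable_gauss: "integrable lborel (\<lambda>x::'a::euclidean_space. complex_of_real (gauss x))"
  unfolding gauss_prod by (intro integral_lborel_prod(2) integrable_real_gauss)

lemma integrable_mult_cis:
  assumes "integrable M f" "h \<in> borel_measurable M"
  shows "integrable M (\<lambda>x. f x * cis (h x))"
  by (rule Bochner_Integration.integrable_bound[OF assms(1)]) (use assms in \<open>auto simp: norm_mult\<close>)

lemma fourier_integral_gauss: "fourier_integral (\<lambda>x. of_real (gauss x)) \<xi> = of_real (gauss \<xi>)"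
proof -
  have "cis (- 2 * pi * (x \<bullet> \<xi>)) = (\<Prod>b\<in>Basis. cis (- 2 * pi * ((x \<bullet> b) * (\<xi> \<bullet> b))))" for x
    by (subst euclidean_inner) (simp add: sum_distrib_left cis_sum[symmetric])
  then have "fourier_integral (\<lambda>x. of_real (gauss x)) \<xi> =
      (LINT x|lborel. (\<Prod>b\<in>Basis. of_real (exp (- pi * (x \<bullet> b)\<^sup>2)) * cis (- 2 * pi * ((x \<bullet> b) * (\<xi> \<bullet> b)))))"
    by (simp add: fourier_integral_def gauss_prod prod.distrib)
  also have "\<dots> = (\<Prod>b\<in>Basis. (LINT y|lborel. of_real (exp (- pi * y\<^sup>2)) * cis (- 2 * pi * (y * (\<xi> \<bullet> b)))))"
    by (intro integral_lborel_prod(1) integrable_mult_cis integrable_real_gauss) measurable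
  finally show ?thesis unfolding gauss_real_fourier by (simp add: gauss_prod)
qed

section \<open>Uniqueness for the Fourier integral\<close>

lemma fourier_integral_measurable [measurable]:
  assumes [measurable]: "f \<in> borel_measurable borel"
  shows "fourier_integral f \<in> borel_measurable borel"
  unfolding fourier_integral_def[abs_def] by measurable

lemma integrable_lborel_pairI:
  fixes u :: "'a::euclidean_space \<Rightarrow> complex" and v :: "'b::euclidean_space \<Rightarrow> complex"
  assumes u: "integrable lborel u" and v: "integrable lborel v"
    and k: "k \<in> borel_measurable (lborel \<Otimes>\<^sub>M lborel)" "\<And>z. cmod (k z) \<le> 1"
  shows "integrable (lborel \<Otimes>\<^sub>M lborel) (\<lambda>(x, y). u x * v y * k (x, y))"
proof -
  note [measurable] = borel_measurable_integrable[OF u] borel_measurable_integrable[OF v] k(1)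
  have *: "integrable lborel (\<lambda>y. u x * v y * k (x, y))" for x
    by (rule Bochner_Integration.integrable_bound[of _ "\<lambda>y. u x * v y"])
       (use v k(2) in \<open>auto simp: norm_mult intro!: mult_left_le\<close>)
  show ?thesis
  proof (rule lborel_pair.Fubini_integrable)
    show "(\<lambda>(x, y). u x * v y * k (x, y)) \<in> borel_measurable (lborel \<Otimes>\<^sub>M lborel)" by measurable
    have "integrable lborel (\<lambda>x. norm (u x) * (LINT y|lborel. norm (v y)))"
      using u by (intro integrable_mult_left integrable_norm)
    then show "integrable lborel (\<lambda>x. LINT y|lborel. norm (case (x, y) of (x, y) \<Rightarrow> u x * v y * k (x, y)))"
    proof (rule Bochner_Integration.integrable_bound)
      show "AE x in lborel. norm (LINT y|lborel. norm (case (x, y) of (x, y) \<Rightarrow> u x * v y * k (x, y)))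
          \<le> norm (norm (u x) * (LINT y|lborel. norm (v y)))"
      proof (rule AE_I2)
        fix x
        have "(LINT y|lborel. norm (u x * v y * k (x, y))) \<le> (LINT y|lborel. norm (u x) * norm (v y))"
          using v k(2) * by (intro integral_mono integrable_norm integrable_mult_right) (auto simp: norm_mult intro!: mult_left_le)
        then show "norm (LINT y|lborel. norm (case (x, y) of (x, y) \<Rightarrow> u x * v y * k (x, y)))
          \<le> norm (norm (u x) * (LINT y|lborel. norm (v y)))" by simp
      qed
    qed measurable
    show "AE x in lborel. integrable lborel (\<lambda>y. case (x, y) of (x, y) \<Rightarrow> u x * v y * k (x, y))"
      using * by simp
  qed
qed

lemma fourier_integral_mult_swap:
  assumes u: "integrable lborel u" and v: "integrable lborel v"
  shows "(LINT \<xi>|lborel. fourier_integral u \<xi> * v \<xi>) = (LINT x|lborel. u x * fourier_integral v x)"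
proof -
  have "(LINT \<xi>|lborel. fourier_integral u \<xi> * v \<xi>) =
      (LINT \<xi>|lborel. LINT x|lborel. u x * v \<xi> * cis (- 2 * pi * (x \<bullet> \<xi>)))"
    by (simp add: fourier_integral_def mult_ac flip: integral_mult_right_zero)
  also have "\<dots> = (LINT x|lborel. LINT \<xi>|lborel. u x * v \<xi> * cis (- 2 * pi * (x \<bullet> \<xi>)))"
  proof (rule lborel_pair.Fubini_integral)
    show "integrable (lborel \<Otimes>\<^sub>M lborel) (\<lambda>(x, \<xi>). u x * v \<xi> * cis (- 2 * pi * (x \<bullet> \<xi>)))"
      using integrable_lborel_pairI[OF u v, of "\<lambda>(x, \<xi>). cis (- 2 * pi * (x \<bullet> \<xi>))"] by (simp add: split_beta')
  qed
  also have "\<dots> = (LINT x|lborel. u x * fourier_integral v x)"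
    by (simp add: fourier_integral_def mult_ac inner_commute flip: integral_mult_right_zero)
  finally show ?thesis .
qed

lemma integral_gauss_eq_0:
  fixes h :: "'a::euclidean_space \<Rightarrow> complex"
  assumes h: "integrable lborel h" and z: "\<And>\<xi>. fourier_integral h \<xi> = 0" and "d \<noteq> 0"
  shows "(LINT x|lborel. h (y + d *\<^sub>R x) * gauss x) = 0"
proof -
  note [measurable] = borel_measurable_integrable[OF h]
  define k where "k x = h (y + d *\<^sub>R x)" for x
  have k: "integrable lborel k" unfolding k_def by (intro integrable_lborel_affine h \<open>d \<noteq> 0\<close>)
  have "fourier_integral k \<xi> = 0" for \<xi>
  proof -
    have "0 = fourier_integral h ((1/d) *\<^sub>R \<xi>)" using z by simp
    also have "\<dots> = \<bar>d\<bar> ^ DIM('a) *\<^sub>R (LINT x|lborel. k x * cis (- 2 * pi * ((y + d *\<^sub>R x) \<bullet> ((1/d) *\<^sub>R \<xi>))))"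
      unfolding fourier_integral_def k_def by (intro integral_lborel_affine) (use \<open>d \<noteq> 0\<close> in measurable)
    also have "\<dots> = \<bar>d\<bar> ^ DIM('a) *\<^sub>R (LINT x|lborel. cis (- 2 * pi * (y \<bullet> \<xi>) / d) * (k x * cis (- 2 * pi * (x \<bullet> \<xi>))))"
      using \<open>d \<noteq> 0\<close> by (intro arg_cong2[where f=scaleR] Bochner_Integration.integral_cong refl)
         (simp add: inner_add_left cis_mult add_divide_distrib distrib_left mult.left_commute[of "cis _" "k _"])
    also have "\<dots> = \<bar>d\<bar> ^ DIM('a) *\<^sub>R (cis (- 2 * pi * (y \<bullet> \<xi>) / d) * fourier_integral k \<xi>)"
      unfolding fourier_integral_def by (subst integral_mult_right_zero) simp
    finally show ?thesis using \<open>d \<noteq> 0\<close> by simp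
  qed
  then have "(LINT \<xi>|lborel. fourier_integral k \<xi> * of_real (gauss \<xi>)) = 0" by simp
  then show ?thesis
    using fourier_integral_mult_swap[OF k integrable_gauss] by (simp add: fourier_integral_gauss k_def)
qed

lemma integral_gauss: "(LINT x|lborel. complex_of_real (gauss x)) = 1"
  using fourier_integral_gauss[of 0] by (simp add: fourier_integral_def gauss_def)

lemma AE_not_frontier_box: "AE z in lborel. z \<notin> frontier (box a b :: 'a::euclidean_space set)"
proof -
  have "AE z in lborel. z \<notin> cbox a b - box a b"
    by (intro AE_not_in null_sets_cbox_Diff_box)
  moreover have "frontier (box a b) \<subseteq> cbox a b - box a b"
    using closure_minimal[of "box a b" "cbox a b"] box_subset_cbox[of a b]
    by (auto simp: frontier_def interior_open[OF open_box])
  ultimately show ?thesis by (auto elim: eventually_mono)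
qed

lemma integral_box_eq_0:
  fixes h :: "'a::euclidean_space \<Rightarrow> complex"
  assumes h: "integrable lborel h" and z: "\<And>\<xi>. fourier_integral h \<xi> = 0"
  shows "(LINT x:box a b|lborel. h x) = 0"
proof -
  note [measurable] = borel_measurable_integrable[OF h, simplified]
  define B where "B = box a b"
  have [measurable]: "B \<in> sets borel" by (simp add: B_def)
  define I where "I d x = (LINT y|lborel. indicator B (y - d *\<^sub>R x) * h y)" for d :: real and x :: 'a
  have [measurable]: "I d \<in> borel_measurable borel" for d unfolding I_def by measurable
  have intB: "integrable lborel (\<lambda>y. indicator B (y - d *\<^sub>R x) * h y)" for d x
    by (rule Bochner_Integration.integrable_bound[OF h]) (auto simp: indicator_def)
  have I0: "(LINT x|lborel. gauss x * I d x) = 0" if "d \<noteq> 0" for d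
  proof -
    have shift: "I d x = (LINT y|lborel. indicator B y * h (y + d *\<^sub>R x))" for x
      using integral_lborel_shift[of "\<lambda>y. indicator B (y - d *\<^sub>R x) * h y" "d *\<^sub>R x"]
      by (simp add: I_def add.commute)
    have "(LINT x|lborel. gauss x * I d x) = (LINT x|lborel. LINT y|lborel. gauss x * (indicator B y * h (y + d *\<^sub>R x)))"
      by (simp add: shift)
    also have "\<dots> = (LINT y|lborel. LINT x|lborel. gauss x * (indicator B y * h (y + d *\<^sub>R x)))"
    proof (rule lborel_pair.Fubini_integral[symmetric])
      have "integrable (lborel \<Otimes>\<^sub>M lborel) (\<lambda>(x::'a, y). gauss x * (indicator B y * h (y + d *\<^sub>R x)))"
      proof (rule lborel_pair.Fubini_integrable)
        have "norm (LINT y|lborel. norm (gauss x * (indicator B y * h (y + d *\<^sub>R x)))) \<le>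
           norm (complex_of_real (gauss x) * of_real (LINT y|lborel. norm (h y)))" for x
        proof -
          have 1: "integrable lborel (\<lambda>y. h (y + d *\<^sub>R x))"
            using integrable_lborel_shift[of h "d *\<^sub>R x"] h by (simp add: add.commute)
          have "(LINT y|lborel. norm (gauss x * (indicator B y * h (y + d *\<^sub>R x)))) \<le> (LINT y|lborel. gauss x * norm (h (y + d *\<^sub>R x)))"
            using 1 gauss_pos[of x]
            by (intro integral_mono' integrable_mult_right integrable_norm) (auto simp: norm_mult indicator_def)
          also have "\<dots> = gauss x * (LINT y|lborel. norm (h y))"
            using integral_lborel_shift[of "\<lambda>y. norm (h y)" "d *\<^sub>R x"] by (simp add: add.commute)
          finally show ?thesis using gauss_pos[of x] by (simp add: norm_mult)
        qed
        then show "integrable lborel (\<lambda>x. LINT y|lborel. norm (case (x, y) of (x, y) \<Rightarrow> gauss x * (indicator B y * h (y + d *\<^sub>R x))))"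
          by (intro Bochner_Integration.integrable_bound[OF integrable_mult_left[OF integrable_gauss,
                of "of_real (LINT y|lborel. norm (h y))"]] AE_I2)
             (simp_all only: prod.case, measurable)
        show "AE x in lborel. integrable lborel (\<lambda>y. case (x, y) of (x, y) \<Rightarrow> gauss x * (indicator B y * h (y + d *\<^sub>R x)))"
        proof (rule AE_I2)
          fix x
          have 1: "integrable lborel (\<lambda>y. h (y + d *\<^sub>R x))"
            using integrable_lborel_shift[of h "d *\<^sub>R x"] h by (simp add: add.commute)
          have "integrable lborel (\<lambda>y. indicator B y * h (y + d *\<^sub>R x))"
            by (rule Bochner_Integration.integrable_bound[OF 1]) (auto simp: indicator_def)
          then show "integrable lborel (\<lambda>y. case (x, y) of (x, y) \<Rightarrow> gauss x * (indicator B y * h (y + d *\<^sub>R x)))" by simp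
        qed
      qed measurable
      then show "integrable (lborel \<Otimes>\<^sub>M lborel) (\<lambda>(x::'a, y). gauss x * (indicator B y * h (y + d *\<^sub>R x)))" .
    qed
    also have "\<dots> = (LINT y|lborel. indicator B y * (LINT x|lborel. h (y + d *\<^sub>R x) * gauss x))"
      by (simp add: mult_ac flip: integral_mult_right_zero)
    also have "\<dots> = 0" using integral_gauss_eq_0[OF h z that] by simp
    finally show ?thesis .
  qed
  define J where "J = (LINT y|lborel. indicator B y * h y)"
  have lim: "(\<lambda>n. I (1 / Suc n) x) \<longlonglongrightarrow> J" for x
    unfolding I_def J_def
  proof (rule integral_dominated_convergence[where w="\<lambda>y. norm (h y)"])
    show "AE y in lborel. (\<lambda>n. indicator B (y - (1 / Suc n) *\<^sub>R x) * h y) \<longlonglongrightarrow> indicator B y * h y"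
      using AE_not_frontier_box[of a b]
    proof eventually_elim
      case (elim y)
      have c: "isCont (indicator B :: 'a \<Rightarrow> real) y" using elim by (simp add: isCont_indicator B_def)
      have "(\<lambda>n. y - (1 / Suc n) *\<^sub>R x) \<longlonglongrightarrow> y - 0 *\<^sub>R x"
        by (intro tendsto_intros LIMSEQ_Suc lim_1_over_n)
      then have "(\<lambda>n. indicator B (y - (1 / Suc n) *\<^sub>R x) :: real) \<longlonglongrightarrow> indicator B y"
        using isCont_tendsto_compose[OF c] by simp
      then have "(\<lambda>n. complex_of_real (indicator B (y - (1 / Suc n) *\<^sub>R x))) \<longlonglongrightarrow> of_real (indicator B y)"
        by (rule tendsto_of_real)
      then show ?case by (intro tendsto_mult tendsto_const) (simp add: of_real_indicator)
    qed
  qed (use h in \<open>auto simp: indicator_def\<close>)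
  have "(\<lambda>n. LINT x|lborel. gauss x * I (1 / Suc n) x) \<longlonglongrightarrow> (LINT x::'a|lborel. gauss x * J)"
  proof (rule integral_dominated_convergence[where w="\<lambda>x::'a. gauss x * (LINT y|lborel. norm (h y))"])
    have "integrable lborel (\<lambda>x::'a. gauss x)"
      using integrable_norm[OF integrable_gauss] by (simp add: abs_of_pos[OF gauss_pos])
    then show "integrable lborel (\<lambda>x::'a. gauss x * (LINT y|lborel. norm (h y)))" by simp
    show "AE x in lborel. (\<lambda>n. gauss x * I (1 / Suc n) x) \<longlonglongrightarrow> gauss x * J"
      by (intro AE_I2 tendsto_mult tendsto_const lim)
    have "norm (I d x) \<le> (LINT y|lborel. norm (h y))" for d x
    proof -
      have "norm (I d x) \<le> (LINT y|lborel. norm (indicator B (y - d *\<^sub>R x) * h y))"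
        unfolding I_def by (rule integral_norm_bound)
      also have "\<dots> \<le> (LINT y|lborel. norm (h y))"
        using h by (intro integral_mono' integrable_norm) (auto simp: indicator_def)
      finally show ?thesis .
    qed
    then show "AE x in lborel. norm (gauss x * I (1 / Suc n) x) \<le> gauss x * (LINT y|lborel. norm (h y))" for n
      by (intro AE_I2) (auto simp: norm_mult abs_of_pos[OF gauss_pos] less_imp_le[OF gauss_pos] intro!: mult_mono)
  qed measurable
  then have "(\<lambda>n. 0) \<longlonglongrightarrow> J"
    unfolding integral_mult_left_zero integral_gauss by (simp add: I0)
  then have "J = 0" by (simp add: LIMSEQ_const_iff)
  then show ?thesis
    by (simp add: J_def B_def set_lebesgue_integral_def scaleR_conv_of_real of_real_indicator)
qed

theorem fourier_integral_eq_0: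
  fixes h :: "'a::euclidean_space \<Rightarrow> complex"
  assumes h: "integrable lborel h" and z: "\<And>\<xi>. fourier_integral h \<xi> = 0"
  shows "AE x in lborel. h x = 0"
proof (rule sigma_finite_measure.density_zero[OF sigma_finite_lborel h])
  fix A :: "'a set" assume "A \<in> sets lborel"
  then have A: "A \<in> sigma_sets UNIV (range (\<lambda>(a, b). box a b))" by (simp add: borel_eq_box)
  have borel: "X \<in> sets borel" if "X \<in> sigma_sets UNIV (range (\<lambda>(a, b). box a b))" for X :: "'a set"
    using that by (simp add: borel_eq_box)
  have si: "set_integrable lborel X h" if "X \<in> sets borel" for X
    using that h unfolding set_integrable_def by (intro integrable_mult_indicator) auto
  have "Int_stable (range (\<lambda>(a, b). box a b::'a set))"
    by (auto simp: Int_stable_def box_Int_box)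
  moreover have "range (\<lambda>(a, b). box a b::'a set) \<subseteq> Pow UNIV" by simp
  ultimately show "(LINT x:A|lborel. h x) = 0" using A
  proof (induction rule: sigma_sets_induct_disjoint)
    case (basic A) then show ?case using integral_box_eq_0[OF h z] by auto
  next
    case empty then show ?case by (simp add: set_lebesgue_integral_def)
  next
    case (compl A)
    have "(LINT x|lborel. h x) = fourier_integral h 0" by (simp add: fourier_integral_def)
    then have "(LINT x:UNIV|lborel. h x) = 0" using z by (simp add: set_lebesgue_integral_def)
    moreover have "(LINT x:A \<union> (UNIV - A)|lborel. h x) = (LINT x:A|lborel. h x) + (LINT x:UNIV - A|lborel. h x)"
      using compl(1)[THEN borel] by (intro set_integral_Un si) auto
    ultimately show ?case using compl(2) by simp
  next
    case (union A)
    have [measurable]: "A i \<in> sets borel" for i using union(2) by (intro borel) auto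
    have "(LINT x:(\<Union>i. A i)|lborel. h x) = (\<Sum>i. LINT x:(A i)|lborel. h x)"
      using union(1) by (intro lebesgue_integral_countable_add si) (auto simp: disjoint_family_on_def)
    then show ?case using union(3) by simp
  qed
qed

section \<open>Plancherel's theorem\<close>

definition gatom :: "'a::euclidean_space \<Rightarrow> 'a \<Rightarrow> 'a \<Rightarrow> complex" where
  "gatom c t x = of_real (gauss (x - c)) * cis (2 * pi * (t \<bullet> x))"

lemma borel_measurable_gatom [measurable]: "gatom c t \<in> borel_measurable borel"
  unfolding gatom_def[abs_def] by measurable

lemma integrable_gatom: "integrable lborel (gatom c t)"
proof -
  have "integrable lborel (\<lambda>x. complex_of_real (gauss (x - c)))"
    using integrable_lborel_shift[of "\<lambda>x. complex_of_real (gauss x)" "- c"] integrable_gauss by simp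
  then show ?thesis unfolding gatom_def[abs_def] by (rule integrable_mult_cis) measurable
qed

lemma gatom_L2: "gatom c t \<in> L2"
proof -
  have "integrable lborel (\<lambda>x. (cmod (gatom c t x))\<^sup>2)"
  proof (rule Bochner_Integration.integrable_bound[OF integrable_gatom])
    have "cmod (gatom c t x) \<le> 1" for x
      using gauss_pos[of "x - c"] by (simp add: gatom_def norm_mult gauss_le_1)
    then show "AE x in lborel. norm ((cmod (gatom c t x))\<^sup>2) \<le> norm (gatom c t x)"
      by (simp add: power2_eq_square mult_left_le)
  qed measurable
  then show ?thesis by (simp add: L2_def)
qed

lemma fourier_integral_gatom: "fourier_integral (gatom c t) = (\<lambda>\<xi>. cis (2 * pi * (c \<bullet> t)) * gatom t (- c) \<xi>)"
proof
  fix \<xi>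
  define F where "F x = gatom c t x * cis (- 2 * pi * (x \<bullet> \<xi>))" for x
  have "fourier_integral (gatom c t) \<xi> = integral\<^sup>L lborel F"
    by (simp only: fourier_integral_def F_def[abs_def])
  also have "\<dots> = (LINT x|lborel. F (c + x))"
    unfolding F_def[abs_def] by (rule integral_lborel_shift[symmetric]) measurable
  also have "\<dots> = (LINT x|lborel. cis (2 * pi * (c \<bullet> (t - \<xi>))) * (of_real (gauss x) * cis (- 2 * pi * (x \<bullet> (\<xi> - t)))))"
  proof (rule Bochner_Integration.integral_cong[OF refl])
    fix x
    have "2 * pi * (t \<bullet> (c + x)) + - 2 * pi * ((c + x) \<bullet> \<xi>) = 2 * pi * (c \<bullet> (t - \<xi>)) + - 2 * pi * (x \<bullet> (\<xi> - t))"
      by (simp add: inner_add_left inner_add_right inner_diff_right inner_commute[of t] algebra_simps)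
    then have "cis (2 * pi * (t \<bullet> (c + x))) * cis (- 2 * pi * ((c + x) \<bullet> \<xi>)) =
        cis (2 * pi * (c \<bullet> (t - \<xi>))) * cis (- 2 * pi * (x \<bullet> (\<xi> - t)))"
      by (simp only: cis_mult)
    then show "F (c + x) = cis (2 * pi * (c \<bullet> (t - \<xi>))) * (of_real (gauss x) * cis (- 2 * pi * (x \<bullet> (\<xi> - t))))"
      unfolding F_def gatom_def add_diff_cancel_left' by (simp only: mult.assoc mult.left_commute)
  qed
  also have "\<dots> = cis (2 * pi * (c \<bullet> (t - \<xi>))) * fourier_integral (\<lambda>x. of_real (gauss x)) (\<xi> - t)"
    unfolding fourier_integral_def by (rule integral_mult_right_zero)
  also have "\<dots> = cis (2 * pi * (c \<bullet> t)) * gatom t (- c) \<xi>"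
    by (simp add: fourier_integral_gauss gatom_def cis_mult mult.left_commute inner_diff_right algebra_simps)
  finally show "fourier_integral (gatom c t) \<xi> = cis (2 * pi * (c \<bullet> t)) * gatom t (- c) \<xi>" .
qed

lemma fourier_integral_scale: "fourier_integral (\<lambda>x. c * f x) = (\<lambda>\<xi>. c * fourier_integral f \<xi>)"
  unfolding fourier_integral_def[abs_def] by (simp add: mult.assoc)

lemma fourier_integral_add:
  assumes "integrable lborel f" "integrable lborel g"
  shows "fourier_integral (\<lambda>x. f x + g x) = (\<lambda>\<xi>. fourier_integral f \<xi> + fourier_integral g \<xi>)"
  unfolding fourier_integral_def[abs_def] using assms
  by (simp add: distrib_right integrable_mult_cis)

lemma fourier_integral_cnj: "fourier_integral (\<lambda>x. cnj (f x)) \<xi> = cnj (fourier_integral f (- \<xi>))"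
  unfolding fourier_integral_def Bochner_Integration.integral_cnj[symmetric] by (simp add: cis_cnj)

lemma integrable_fourier_integral_gatom: "integrable lborel (fourier_integral (gatom c t))"
  unfolding fourier_integral_gatom by (intro integrable_mult_right integrable_gatom)

lemma fourier_integral_gatom_L2: "fourier_integral (gatom c t) \<in> L2"
  unfolding fourier_integral_gatom by (intro L2_scale gatom_L2)

lemma l2inner_fourier_gatom:
  assumes "integrable lborel u"
  shows "l2inner (fourier_integral u) (fourier_integral (gatom c t)) = l2inner u (gatom c t)"
proof -
  have "fourier_integral (\<lambda>\<xi>. cnj (fourier_integral (gatom c t) \<xi>)) x = cnj (gatom c t x)" for x
  proof -
    have "fourier_integral (fourier_integral (gatom c t)) y = gatom (- c) (- t) y" for y
      unfolding fourier_integral_gatom fourier_integral_scale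
      by (simp add: mult.assoc[symmetric] cis_mult inner_commute)
    then show ?thesis
      unfolding fourier_integral_cnj by (simp add: gatom_def) (metis gauss_minus minus_diff_eq uminus_add_conv_diff add.commute diff_conv_add_uminus)
  qed
  moreover have "integrable lborel (\<lambda>\<xi>. cnj (fourier_integral (gatom c t) \<xi>))"
    using integrable_fourier_integral_gatom by simp
  ultimately show ?thesis
    unfolding l2inner_def using fourier_integral_mult_swap[OF assms] by simp
qed

lemma gatom_total:
  assumes f: "f \<in> L2" and z: "\<And>t. l2inner f (gatom 0 t) = 0"
  shows "AE x in lborel. f x = 0"
proof -
  define h where "h x = f x * of_real (gauss x)" for x
  have "integrable lborel (\<lambda>x. f x * gatom 0 0 x)" by (intro L2_mult_integrable f gatom_L2)
  then have h: "integrable lborel h" by (simp add: h_def[abs_def] gatom_def)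
  have "fourier_integral h \<xi> = 0" for \<xi>
  proof -
    have "fourier_integral h \<xi> = l2inner f (gatom 0 \<xi>)"
      unfolding fourier_integral_def l2inner_def h_def gatom_def
      by (simp add: cis_cnj inner_commute mult.assoc)
    then show ?thesis using z by simp
  qed
  from fourier_integral_eq_0[OF h this] show ?thesis
  proof eventually_elim
    case (elim x)
    then show ?case using gauss_pos[of x] by (simp add: h_def)
  qed
qed

definition gatoms :: "('a::euclidean_space \<Rightarrow> complex) set" where
  "gatoms = {gatom c t | c t. True}"

lemma gatoms_L2: "gatoms \<subseteq> L2" "fourier_integral ` gatoms \<subseteq> L2"
  by (auto simp: gatoms_def gatom_L2 fourier_integral_gatom_L2)

lemma closed_span_gatoms: "closed_span gatoms = L2"
  by (rule closed_span_eqI[OF closed_subspace_L2 gatoms_L2(1)], rule gatom_total) (auto simp: gatoms_def)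

lemma fourier_gatoms_total:
  assumes f: "f \<in> L2" and z: "\<And>c t. l2inner f (fourier_integral (gatom c t)) = 0"
  shows "AE x in lborel. f x = 0"
proof (rule gatom_total[OF f])
  fix t
  show "l2inner f (gatom 0 t) = 0"
    using z[of "- t" 0] by (simp add: fourier_integral_gatom l2inner_scale_right)
qed

lemma closed_span_fourier_gatoms: "closed_span (fourier_integral ` gatoms) = L2"
  by (rule closed_span_eqI[OF closed_subspace_L2 gatoms_L2(2)], rule fourier_gatoms_total) (auto simp: gatoms_def)

lemma integrable_lin_span_gatoms: "p \<in> lin_span gatoms \<Longrightarrow> integrable lborel p"
proof (induction rule: lin_span_induct)
  case (add c s f)
  then obtain a t where "s = gatom a t" by (auto simp: gatoms_def)
  then show ?case using add by (intro Bochner_Integration.integrable_add integrable_mult_right) (auto intro: integrable_gatom)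
qed simp

text \<open>\<open>weak_fourier\<close> turns out to be the same relation as \<open>has_fourier\<close>, but it is
  stable under sums and limits for trivial reasons.\<close>

definition weak_fourier :: "('a::euclidean_space \<Rightarrow> complex) \<Rightarrow> ('a \<Rightarrow> complex) \<Rightarrow> bool" where
  "weak_fourier f g \<longleftrightarrow> f \<in> L2 \<and> g \<in> L2 \<and>
     (\<forall>c t. l2inner f (gatom c t) = l2inner g (fourier_integral (gatom c t)))"

lemma has_fourier_imp_weak:
  assumes "has_fourier f g"
  shows "weak_fourier f g"
proof -
  obtain u where u: "\<And>n. integrable lborel (u n)" "l2_tendsto u f" "l2_tendsto (\<lambda>n. fourier_integral (u n)) g"
    using assms by (auto simp: has_fourier_def)
  have "l2inner f (gatom c t) = l2inner g (fourier_integral (gatom c t))" for c t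
  proof (rule LIMSEQ_unique)
    show "(\<lambda>n. l2inner (u n) (gatom c t)) \<longlonglongrightarrow> l2inner f (gatom c t)"
      by (intro l2_tendsto_inner l2_tendsto_const gatom_L2 u)
    have "(\<lambda>n. l2inner (fourier_integral (u n)) (fourier_integral (gatom c t))) \<longlonglongrightarrow> l2inner g (fourier_integral (gatom c t))"
      by (intro l2_tendsto_inner l2_tendsto_const fourier_integral_gatom_L2 u)
    then show "(\<lambda>n. l2inner (u n) (gatom c t)) \<longlonglongrightarrow> l2inner g (fourier_integral (gatom c t))"
      by (simp add: l2inner_fourier_gatom u(1))
  qed
  then show ?thesis using u by (simp add: weak_fourier_def l2_tendsto_def)
qed

lemma weak_fourier_scale: "weak_fourier f g \<Longrightarrow> weak_fourier (\<lambda>x. c * f x) (\<lambda>x. c * g x)"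
  by (auto simp: weak_fourier_def l2inner_scale_left L2_scale)

lemma weak_fourier_add:
  "weak_fourier f g \<Longrightarrow> weak_fourier f' g' \<Longrightarrow> weak_fourier (\<lambda>x. f x + f' x) (\<lambda>x. g x + g' x)"
  by (auto simp: weak_fourier_def l2inner_add_left L2_add gatom_L2 fourier_integral_gatom_L2)

lemma weak_fourier_unique:
  assumes "weak_fourier f g" "weak_fourier f g'"
  shows "AE x in lborel. g x = g' x"
proof -
  have "AE x in lborel. g x - g' x = 0"
    by (rule fourier_gatoms_total)
       (use assms in \<open>auto simp: weak_fourier_def L2_diff l2inner_diff_left fourier_integral_gatom_L2\<close>)
  then show ?thesis by simp
qed

lemma lin_span_gatoms_fourier:
  assumes "p \<in> lin_span gatoms"
  shows "weak_fourier p (fourier_integral p)"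
    and "weak_fourier f g \<Longrightarrow> l2inner p f = l2inner (fourier_integral p) g"
proof -
  have "weak_fourier p (fourier_integral p) \<and> (weak_fourier f g \<longrightarrow> l2inner p f = l2inner (fourier_integral p) g)"
    using assms
  proof (induction rule: lin_span_induct)
    case zero
    have "fourier_integral (\<lambda>x::'a. 0) = (\<lambda>x. 0)" by (simp add: fourier_integral_def[abs_def])
    then show ?case by (simp add: weak_fourier_def)
  next
    case (add d s p)
    obtain c t where s: "s = gatom c t" using add(1) by (auto simp: gatoms_def)
    have si: "integrable lborel s" by (simp add: s integrable_gatom)
    have eq: "fourier_integral (\<lambda>x. d * s x + p x) = (\<lambda>\<xi>. d * fourier_integral s \<xi> + fourier_integral p \<xi>)"
      using fourier_integral_add[OF integrable_mult_right[OF si] integrable_lin_span_gatoms[OF add(2)], of d]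
      by (simp add: fourier_integral_scale)
    have ws: "weak_fourier s (fourier_integral s)"
      unfolding weak_fourier_def using l2inner_fourier_gatom[OF si]
      by (auto simp: s gatom_L2 fourier_integral_gatom_L2)
    have "l2inner (\<lambda>x. d * s x + p x) f = l2inner (\<lambda>\<xi>. d * fourier_integral s \<xi> + fourier_integral p \<xi>) g"
      if w: "weak_fourier f g"
    proof -
      have "l2inner s f = l2inner (fourier_integral s) g"
        using w unfolding weak_fourier_def s by (metis l2inner_commute)
      moreover have "l2inner p f = l2inner (fourier_integral p) g" using add(3) w by blast
      moreover have "p \<in> L2" "fourier_integral p \<in> L2" using add(3) by (auto simp: weak_fourier_def)
      ultimately show ?thesis
        using w ws by (simp add: weak_fourier_def l2inner_add_left l2inner_scale_left L2_scale)
    qed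
    moreover have "weak_fourier (\<lambda>x. d * s x + p x) (\<lambda>\<xi>. d * fourier_integral s \<xi> + fourier_integral p \<xi>)"
      using add(3) by (intro weak_fourier_add weak_fourier_scale ws) blast
    ultimately show ?case unfolding eq by blast
  qed
  then show "weak_fourier p (fourier_integral p)"
    and "weak_fourier f g \<Longrightarrow> l2inner p f = l2inner (fourier_integral p) g" by auto
qed

lemma lin_span_gatoms_diff:
  assumes "p \<in> lin_span gatoms" "q \<in> lin_span gatoms"
  shows "l2norm (\<lambda>x. fourier_integral p x - fourier_integral q x) = l2norm (\<lambda>x. p x - q x)"
proof -
  define r where "r x = p x + (- 1) * q x" for x
  have r: "r \<in> lin_span gatoms" unfolding r_def[abs_def] by (intro lin_span_add lin_span_scale assms)
  have "fourier_integral r = (\<lambda>x. fourier_integral p x - fourier_integral q x)"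
  proof -
    have "fourier_integral r = (\<lambda>x. fourier_integral p x + fourier_integral (\<lambda>x. (- 1) * q x) x)"
      unfolding r_def[abs_def]
      by (intro fourier_integral_add integrable_mult_right integrable_lin_span_gatoms assms)
    then show ?thesis unfolding fourier_integral_scale by simp
  qed
  moreover have "l2inner r r = l2inner (fourier_integral r) (fourier_integral r)"
    using lin_span_gatoms_fourier[OF r] by blast
  then have "(l2norm r)\<^sup>2 = (l2norm (fourier_integral r))\<^sup>2"
    unfolding l2inner_self by (simp only: of_real_eq_iff)
  then have "l2norm r = l2norm (fourier_integral r)" by (simp add: power2_eq_iff_nonneg)
  ultimately show ?thesis by (simp add: r_def[abs_def])
qed

lemma lin_span_fourier_gatoms:
  assumes "q \<in> lin_span (fourier_integral ` gatoms)"
  shows "\<exists>p\<in>lin_span gatoms. fourier_integral p = q"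
  using assms
proof (induction rule: lin_span_induct)
  case zero
  show ?case by (rule bexI[of _ "\<lambda>x. 0"]) (auto simp: fourier_integral_def[abs_def] lin_span_zero)
next
  case (add c s f)
  obtain p where p: "p \<in> lin_span gatoms" "fourier_integral p = f" using add by auto
  obtain g where g: "g \<in> gatoms" "s = fourier_integral g" using add by auto
  have "fourier_integral (\<lambda>x. c * g x + p x) = (\<lambda>x. c * s x + f x)"
    using integrable_lin_span_gatoms p g lin_span_superset[OF g(1)]
    by (subst fourier_integral_add) (auto simp: fourier_integral_scale)
  then show ?case using lin_span_add[OF lin_span_scale[OF lin_span_superset[OF g(1)]] p(1)] by blast
qed

lemma has_fourier_approx_ex:
  assumes "f \<in> L2"
  obtains u g where "\<And>n. u n \<in> lin_span gatoms" "l2_tendsto u f" "l2_tendsto (\<lambda>n. fourier_integral (u n)) g"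
proof -
  obtain u where u: "\<And>n. u n \<in> lin_span gatoms" "l2_tendsto u f"
    using assms closed_span_gatoms unfolding closed_span_def by auto
  have "fourier_integral (u n) \<in> L2" for n using lin_span_gatoms_fourier(1)[OF u(1)] by (simp add: weak_fourier_def)
  then obtain g where "l2_tendsto (\<lambda>n. fourier_integral (u n)) g"
    using l2_complete[of "\<lambda>n. fourier_integral (u n)"] l2_tendsto_imp_Cauchy[OF u(2)]
    by (auto simp: lin_span_gatoms_diff u(1))
  with u that show ?thesis by blast
qed

lemma weak_fourier_approx:
  assumes w: "weak_fourier f g"
  obtains u where "\<And>n. u n \<in> lin_span gatoms" "l2_tendsto u f" "l2_tendsto (\<lambda>n. fourier_integral (u n)) g"
proof -
  obtain u g' where u: "\<And>n. u n \<in> lin_span gatoms" "l2_tendsto u f" "l2_tendsto (\<lambda>n. fourier_integral (u n)) g'"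
    using has_fourier_approx_ex[of f] w by (auto simp: weak_fourier_def)
  then have "has_fourier f g'"
    unfolding has_fourier_def by (intro exI[of _ u]) (auto intro: integrable_lin_span_gatoms)
  from weak_fourier_unique[OF has_fourier_imp_weak[OF this] w]
  have "l2_tendsto (\<lambda>n. fourier_integral (u n)) g"
    using w by (intro l2_tendsto_cong_AE[OF u(3)]) (auto simp: weak_fourier_def L2_def)
  with u that show ?thesis by blast
qed

lemma has_fourier_iff_weak: "has_fourier f g \<longleftrightarrow> weak_fourier f g"
proof
  assume "weak_fourier f g"
  then show "has_fourier f g"
    using weak_fourier_approx[of f g] by (metis has_fourier_def integrable_lin_span_gatoms)
qed (rule has_fourier_imp_weak)

lemma has_fourier_L2: "has_fourier f g \<Longrightarrow> f \<in> L2" "has_fourier f g \<Longrightarrow> g \<in> L2"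
  by (auto simp: has_fourier_iff_weak weak_fourier_def)

lemmas has_fourier_add = weak_fourier_add[folded has_fourier_iff_weak]
  and has_fourier_scale = weak_fourier_scale[folded has_fourier_iff_weak]
  and has_fourier_unique = weak_fourier_unique[folded has_fourier_iff_weak]

lemma has_fourier_diff:
  "has_fourier f g \<Longrightarrow> has_fourier f' g' \<Longrightarrow> has_fourier (\<lambda>x. f x - f' x) (\<lambda>x. g x - g' x)"
  using has_fourier_add[of f g "\<lambda>x. - 1 * f' x" "\<lambda>x. - 1 * g' x"] has_fourier_scale[of f' g' "- 1"] by simp

lemma has_fourier_cong_AE:
  assumes "has_fourier f g" "g' \<in> borel_measurable borel" "AE x in lborel. g x = g' x"
  shows "has_fourier f g'"
  using assms l2_tendsto_cong_AE unfolding has_fourier_def by blast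

lemma has_fourier_ex: "f \<in> L2 \<Longrightarrow> \<exists>g. has_fourier f g"
  using has_fourier_approx_ex[of f] by (metis has_fourier_def integrable_lin_span_gatoms)

theorem has_fourier_inner:
  assumes "has_fourier f g" "has_fourier f' g'"
  shows "l2inner f f' = l2inner g g'"
proof -
  obtain u where u: "\<And>n. u n \<in> lin_span gatoms" "l2_tendsto u f" "l2_tendsto (\<lambda>n. fourier_integral (u n)) g"
    using weak_fourier_approx assms(1) has_fourier_iff_weak by blast
  have eq: "l2inner (u n) f' = l2inner (fourier_integral (u n)) g'" for n
    using lin_span_gatoms_fourier(2)[OF u(1)] assms(2) has_fourier_iff_weak by blast
  have "(\<lambda>n. l2inner (u n) f') \<longlonglongrightarrow> l2inner f f'"
    by (intro l2_tendsto_inner u l2_tendsto_const has_fourier_L2[OF assms(2)])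
  moreover have "(\<lambda>n. l2inner (fourier_integral (u n)) g') \<longlonglongrightarrow> l2inner g g'"
    by (intro l2_tendsto_inner u l2_tendsto_const has_fourier_L2[OF assms(2)])
  ultimately show ?thesis unfolding eq by (rule LIMSEQ_unique)
qed

lemma has_fourier_norm:
  assumes "has_fourier f g"
  shows "l2norm f = l2norm g"
  using has_fourier_inner[OF assms assms] unfolding l2inner_self
  by (simp add: power2_eq_iff_nonneg flip: of_real_power)

lemma has_fourier_ex_inverse:
  assumes "g \<in> L2"
  shows "\<exists>f. has_fourier f g"
proof -
  obtain v where v: "\<And>n. v n \<in> lin_span (fourier_integral ` gatoms)" "l2_tendsto v g"
    using assms closed_span_fourier_gatoms unfolding closed_span_def by auto
  obtain u where u: "\<And>n. u n \<in> lin_span gatoms" "\<And>n. fourier_integral (u n) = v n"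
    using lin_span_fourier_gatoms[OF v(1)] by metis
  have "l2norm (\<lambda>x. v m x - v n x) = l2norm (\<lambda>x. u m x - u n x)" for m n
    using lin_span_gatoms_diff[OF u(1) u(1)] by (simp add: u(2))
  then have C: "\<exists>N. \<forall>m\<ge>N. \<forall>n\<ge>N. l2norm (\<lambda>x. u m x - u n x) < e" if "e > 0" for e
    using l2_tendsto_imp_Cauchy[OF v(2) that] by simp
  have "u n \<in> L2" for n using u(1) lin_span_L2[OF gatoms_L2(1)] by blast
  then obtain f where "l2_tendsto u f"
    using C by (rule l2_complete)
  then have "has_fourier f g"
    unfolding has_fourier_def using u v integrable_lin_span_gatoms by (intro exI[of _ u]) auto
  then show ?thesis by blast
qed

lemma has_fourier_fourier: "f \<in> L2 \<Longrightarrow> has_fourier f (fourier f)"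
  unfolding fourier_def using has_fourier_ex by (rule someI_ex)

lemma has_fourier_inverse_fourier: "g \<in> L2 \<Longrightarrow> has_fourier (inverse_fourier g) g"
  unfolding inverse_fourier_def using has_fourier_ex_inverse by (rule someI_ex)

lemma has_fourier_closed_span:
  assumes fg: "has_fourier f g" and S: "S \<subseteq> L2" and T: "T \<subseteq> L2"
    and ST: "\<And>s. s \<in> S \<Longrightarrow> \<exists>t\<in>T. has_fourier s t"
    and TS: "\<And>t. t \<in> T \<Longrightarrow> \<exists>s\<in>S. has_fourier s t"
  shows "f \<in> closed_span S \<longleftrightarrow> g \<in> closed_span T"
proof
  assume f: "f \<in> closed_span S"
  have "closed_subspace {f. \<exists>g\<in>closed_span T. has_fourier f g}"
    by (rule closed_subspace_preimage[OF closed_subspace_closed_span[OF T], where C=1])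
       (auto simp: has_fourier_add has_fourier_scale has_fourier_norm has_fourier_ex intro: has_fourier_L2)
  moreover have "S \<subseteq> {f. \<exists>g\<in>closed_span T. has_fourier f g}"
    using ST closed_span_superset[OF T] by fast
  ultimately obtain g' where "g' \<in> closed_span T" "has_fourier f g'"
    using f closed_span_minimal by blast
  then show "g \<in> closed_span T"
    using closed_subspace_cong_AE[OF closed_subspace_closed_span[OF T] _ _ has_fourier_unique[of f g' g]]
      fg L2_D(1)[OF has_fourier_L2(2)[OF fg]] by blast
next
  assume g: "g \<in> closed_span T"
  have "closed_subspace {g. \<exists>f\<in>closed_span S. has_fourier f g}"
    by (rule closed_subspace_preimage[OF closed_subspace_closed_span[OF S], where C=1])
       (auto simp: has_fourier_add has_fourier_scale has_fourier_norm has_fourier_ex_inverse intro: has_fourier_L2)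
  moreover have "T \<subseteq> {g. \<exists>f\<in>closed_span S. has_fourier f g}"
    using TS closed_span_superset[OF S] by fast
  ultimately obtain f' where f': "f' \<in> closed_span S" "has_fourier f' g"
    using g closed_span_minimal by blast
  have "l2norm (\<lambda>x. f' x - f x) = 0"
    using has_fourier_norm[OF has_fourier_diff[OF f'(2) fg]] by simp
  then have "AE x in lborel. f' x = f x"
    using l2norm_eq_0_iff[OF L2_diff[OF has_fourier_L2(1)[OF f'(2)] has_fourier_L2(1)[OF fg]]] by simp
  then show "f \<in> closed_span S"
    using closed_subspace_cong_AE[OF closed_subspace_closed_span[OF S] f'(1)]
      L2_D(1)[OF has_fourier_L2(1)[OF fg]] by blast
qed

lemma l2_tendsto_comp:
  assumes T: "\<And>h. h \<in> L2 \<Longrightarrow> (\<lambda>x. m x * h (s x)) \<in> L2"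
    "\<And>h. h \<in> L2 \<Longrightarrow> l2norm (\<lambda>x. m x * h (s x)) = C * l2norm h"
    and u: "l2_tendsto u f"
  shows "l2_tendsto (\<lambda>n x. m x * u n (s x)) (\<lambda>x. m x * f (s x))"
proof (rule l2_tendstoI[where C="\<lambda>n. C * l2norm (\<lambda>x. u n x - f x)"])
  note L = l2_tendsto_L2[OF u]
  show "l2norm (\<lambda>x. m x * u n (s x) - m x * f (s x)) \<le> C * l2norm (\<lambda>x. u n x - f x)" for n
    using T(2)[OF L2_diff[OF L(1)[of n] L(2)]] by (simp add: right_diff_distrib)
  show "(\<lambda>n. C * l2norm (\<lambda>x. u n x - f x)) \<longlonglongrightarrow> 0"
    using u by (intro tendsto_mult_right_zero) (auto simp: l2_tendsto_def)
qed (use u in \<open>auto simp: l2_tendsto_def T(1)\<close>)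

lemma L2_shift:
  assumes "f \<in> L2"
  shows "(\<lambda>x. f (c + x)) \<in> L2" "l2norm (\<lambda>x. f (c + x)) = l2norm f"
proof -
  note [measurable] = L2_D(1)[OF assms]
  show "(\<lambda>x. f (c + x)) \<in> L2"
    using integrable_lborel_shift[of "\<lambda>x. (cmod (f x))\<^sup>2" c] L2_D(2)[OF assms] by (simp add: L2_def)
  show "l2norm (\<lambda>x. f (c + x)) = l2norm f"
    unfolding l2norm_def using integral_lborel_shift[of "\<lambda>x. (cmod (f x))\<^sup>2" c] by simp
qed

lemma L2_modulate:
  assumes "f \<in> L2" and [measurable]: "h \<in> borel_measurable borel"
  shows "(\<lambda>x. cis (h x) * f x) \<in> L2" "l2norm (\<lambda>x. cis (h x) * f x) = l2norm f"
proof -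
  note [measurable] = L2_D(1)[OF assms(1)]
  show "(\<lambda>x. cis (h x) * f x) \<in> L2" "l2norm (\<lambda>x. cis (h x) * f x) = l2norm f"
    using L2_D(2)[OF assms(1)] by (simp_all add: L2_def l2norm_def norm_mult)
qed

lemma L2_dilate:
  fixes f :: "real \<Rightarrow> complex"
  assumes "f \<in> L2" "a > 0"
  shows "(\<lambda>x. f (a * x)) \<in> L2" "l2norm (\<lambda>x. f (a * x)) = sqrt (1 / a) * l2norm f"
proof -
  note [measurable] = L2_D(1)[OF assms(1)]
  show "(\<lambda>x. f (a * x)) \<in> L2"
    using lborel_integrable_real_affine[of "\<lambda>x. (cmod (f x))\<^sup>2" a 0] L2_D(2)[OF assms(1)] assms(2)
    by (simp add: L2_def)
  have "(LINT x|lborel. (cmod (f x))\<^sup>2) = a * (LINT x|lborel. (cmod (f (a * x)))\<^sup>2)"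
    using lborel_integral_real_affine[of a "\<lambda>x. (cmod (f x))\<^sup>2" 0] assms(2) by simp
  then show "l2norm (\<lambda>x. f (a * x)) = sqrt (1 / a) * l2norm f"
    using assms(2) by (simp add: l2norm_def flip: real_sqrt_mult)
qed

lemma has_fourier_shift:
  assumes "has_fourier f g"
  shows "has_fourier (\<lambda>x. f (c + x)) (\<lambda>\<xi>. cis (2 * pi * (c \<bullet> \<xi>)) * g \<xi>)"
proof -
  obtain u where u: "\<And>n. integrable lborel (u n)" "l2_tendsto u f" "l2_tendsto (\<lambda>n. fourier_integral (u n)) g"
    using assms by (auto simp: has_fourier_def)
  note [measurable] = borel_measurable_integrable[OF u(1), simplified]
  have "fourier_integral (\<lambda>x. u n (c + x)) = (\<lambda>\<xi>. cis (2 * pi * (c \<bullet> \<xi>)) * fourier_integral (u n) \<xi>)" for n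
  proof
    fix \<xi>
    define G where "G y = u n y * cis (- 2 * pi * ((y - c) \<bullet> \<xi>))" for y
    have "fourier_integral (\<lambda>x. u n (c + x)) \<xi> = (LINT x|lborel. G (c + x))"
      by (simp only: fourier_integral_def G_def add_diff_cancel_left')
    also have "\<dots> = integral\<^sup>L lborel G"
      unfolding G_def[abs_def] by (rule integral_lborel_shift) measurable
    also have "\<dots> = (LINT y|lborel. cis (2 * pi * (c \<bullet> \<xi>)) * (u n y * cis (- 2 * pi * (y \<bullet> \<xi>))))"
      by (rule Bochner_Integration.integral_cong[OF refl])
         (simp add: G_def mult.left_commute[of _ "u n _"] cis_mult inner_diff_left algebra_simps)
    also have "\<dots> = cis (2 * pi * (c \<bullet> \<xi>)) * fourier_integral (u n) \<xi>"
      unfolding fourier_integral_def by (rule integral_mult_right_zero)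
    finally show "fourier_integral (\<lambda>x. u n (c + x)) \<xi> = cis (2 * pi * (c \<bullet> \<xi>)) * fourier_integral (u n) \<xi>" .
  qed
  moreover have "l2_tendsto (\<lambda>n x. u n (c + x)) (\<lambda>x. f (c + x))"
    using l2_tendsto_comp[of "\<lambda>_. 1" "\<lambda>x. c + x" 1, OF _ _ u(2)] by (simp add: L2_shift)
  moreover have "l2_tendsto (\<lambda>n \<xi>. cis (2 * pi * (c \<bullet> \<xi>)) * fourier_integral (u n) \<xi>) (\<lambda>\<xi>. cis (2 * pi * (c \<bullet> \<xi>)) * g \<xi>)"
    using l2_tendsto_comp[of "\<lambda>\<xi>. cis (2 * pi * (c \<bullet> \<xi>))" "\<lambda>\<xi>. \<xi>" 1, OF _ _ u(3)] by (simp add: L2_modulate)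
  ultimately show ?thesis
    unfolding has_fourier_def using u(1) integrable_lborel_shift[of "u _" c]
    by (intro exI[of _ "\<lambda>n x. u n (c + x)"]) auto
qed

lemma has_fourier_dilate:
  fixes f g :: "real \<Rightarrow> complex"
  assumes "has_fourier f g" "a > 0"
  shows "has_fourier (\<lambda>x. f (a * x)) (\<lambda>\<xi>. of_real (1 / a) * g (\<xi> / a))"
proof -
  obtain u where u: "\<And>n. integrable lborel (u n)" "l2_tendsto u f" "l2_tendsto (\<lambda>n. fourier_integral (u n)) g"
    using assms by (auto simp: has_fourier_def)
  have "fourier_integral (\<lambda>x. u n (a * x)) = (\<lambda>\<xi>. of_real (1 / a) * fourier_integral (u n) (\<xi> / a))" for n
  proof
    fix \<xi>
    have "fourier_integral (u n) (\<xi> / a) = \<bar>a\<bar> *\<^sub>R (LINT x|lborel. u n (0 + a * x) * cis (- 2 * pi * ((0 + a * x) \<bullet> (\<xi> / a))))"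
      unfolding fourier_integral_def using assms(2) by (intro lborel_integral_real_affine) simp
    also have "\<dots> = of_real a * fourier_integral (\<lambda>x. u n (a * x)) \<xi>"
      using assms(2) by (simp add: fourier_integral_def scaleR_conv_of_real)
    finally show "fourier_integral (\<lambda>x. u n (a * x)) \<xi> = of_real (1 / a) * fourier_integral (u n) (\<xi> / a)"
      using assms(2) by simp
  qed
  moreover have "l2_tendsto (\<lambda>n x. u n (a * x)) (\<lambda>x. f (a * x))"
    using l2_tendsto_comp[of "\<lambda>_. 1" "\<lambda>x. a * x" "sqrt (1 / a)", OF _ _ u(2)] L2_dilate assms(2) by simp
  moreover have "l2_tendsto (\<lambda>n \<xi>. of_real (1 / a) * fourier_integral (u n) (\<xi> / a)) (\<lambda>\<xi>. of_real (1 / a) * g (\<xi> / a))"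
  proof (rule l2_tendsto_comp[OF _ _ u(3), where C="(1 / a) * sqrt a"])
    fix h :: "real \<Rightarrow> complex" assume "h \<in> L2"
    from L2_dilate[OF this, of "1 / a"] assms(2)
    have 1: "(\<lambda>\<xi>. h (\<xi> / a)) \<in> L2" "l2norm (\<lambda>\<xi>. h (\<xi> / a)) = sqrt a * l2norm h" by simp_all
    show "(\<lambda>\<xi>. of_real (1 / a) * h (\<xi> / a)) \<in> L2" by (rule L2_scale[OF 1(1)])
    show "l2norm (\<lambda>\<xi>. of_real (1 / a) * h (\<xi> / a)) = (1 / a) * sqrt a * l2norm h"
      unfolding l2norm_scale 1(2) using assms(2) by (simp add: norm_divide)
  qed
  moreover have "integrable lborel (\<lambda>x. u n (a * x))" for n
    using lborel_integrable_real_affine[OF u(1)[of n], of a 0] assms(2) by simp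
  ultimately show ?thesis
    unfolding has_fourier_def
    by (intro exI[of _ "\<lambda>n x. u n (a * x)"]) auto
qed

section \<open>The change of variables\<close>

lemma abs_antiderivative: "((\<lambda>x::real. x * \<bar>x\<bar> / 2) has_real_derivative \<bar>x\<bar>) (at x)"
proof -
  consider "x > 0" | "x < 0" | "x = 0" by linarith
  then show ?thesis
  proof cases
    case 1
    have "((\<lambda>x. x * x / 2) has_real_derivative \<bar>x\<bar>) (at x)"
      using 1 by (auto intro!: derivative_eq_intros)
    then show ?thesis
      by (rule has_field_derivative_transform_within_open[of _ _ _ "{0<..}"]) (use 1 in auto)
  next
    case 2
    have "((\<lambda>x. - (x * x / 2)) has_real_derivative \<bar>x\<bar>) (at x)"
      using 2 by (auto intro!: derivative_eq_intros)
    then show ?thesis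
      by (rule has_field_derivative_transform_within_open[of _ _ _ "{..<0}"]) (use 2 in auto)
  next
    case 3
    have "((\<lambda>h::real. \<bar>h\<bar> / 2) \<longlongrightarrow> \<bar>0\<bar> / 2) (at 0)" by (intro tendsto_intros) simp
    then have "((\<lambda>h::real. \<bar>h\<bar> / 2) \<longlongrightarrow> 0) (at 0)" by simp
    then have "((\<lambda>h::real. ((0 + h) * \<bar>0 + h\<bar> / 2 - 0 * \<bar>0\<bar> / 2) / h) \<longlongrightarrow> 0) (at 0)"
      by (rule Lim_transform_eventually) (auto simp: eventually_at_filter)
    then show ?thesis unfolding 3 DERIV_def by simp
  qed
qed

lemma strict_mono_mult_abs: "strict_mono (\<lambda>x::real. x * \<bar>x\<bar> / 2)"
proof (rule strict_monoI)
  fix x y :: real assume "x < y"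
  consider "0 \<le> x" | "y \<le> 0" | "x < 0" "0 < y" by linarith
  then have "x * \<bar>x\<bar> < y * \<bar>y\<bar>"
  proof cases
    case 1 then show ?thesis using \<open>x < y\<close> by (simp add: mult_strict_mono')
  next
    case 2
    then have "(- y) * (- y) < (- x) * (- x)" using \<open>x < y\<close> by (intro mult_strict_mono') auto
    then show ?thesis using 2 \<open>x < y\<close> by simp
  next
    case 3
    then have "x * \<bar>x\<bar> < 0" "0 < y * \<bar>y\<bar>" by (auto simp: abs_if zero_less_mult_iff)
    then show ?thesis by simp
  qed
  then show "x * \<bar>x\<bar> / 2 < y * \<bar>y\<bar> / 2" by simp
qed

lemma mult_abs_surj: "\<exists>x::real. x * \<bar>x\<bar> / 2 = s"
proof (cases "s \<ge> 0")
  case True then show ?thesis by (intro exI[of _ "sqrt (2 * s)"]) simp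
next
  case False then show ?thesis by (intro exI[of _ "- sqrt (- 2 * s)"]) simp
qed

lemma distr_mult_abs:
  "distr (density lborel (\<lambda>x::real. ennreal \<bar>x\<bar>)) borel (\<lambda>x. x * \<bar>x\<bar> / 2) = lborel"
proof (rule lborel_eqI[symmetric])
  fix l u :: real assume "\<And>b. b \<in> Basis \<Longrightarrow> l \<bullet> b \<le> u \<bullet> b"
  then have "l \<le> u" by simp
  let ?q = "\<lambda>x::real. x * \<bar>x\<bar> / 2"
  obtain a b where ab: "?q a = l" "?q b = u" using mult_abs_surj by metis
  note less = strict_mono_less[OF strict_mono_mult_abs] and le = strict_mono_less_eq[OF strict_mono_mult_abs]
  have "a \<le> b" using \<open>l \<le> u\<close> le[of a b] unfolding ab by simp
  have "?q -` box l u = {a<..<b}"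
    unfolding ab[symmetric] using less[of a] less[of _ b] by (auto simp: box_real simp del: times_divide_eq_left)
  then have "emeasure (distr (density lborel (\<lambda>x. ennreal \<bar>x\<bar>)) borel ?q) (box l u) =
      emeasure (density lborel (\<lambda>x. ennreal \<bar>x\<bar>)) {a<..<b}"
    by (simp add: emeasure_distr)
  also have "\<dots> = (\<integral>\<^sup>+x. ennreal \<bar>x\<bar> * indicator {a<..<b} x \<partial>lborel)"
    by (rule emeasure_density) auto
  also have "\<dots> = (\<integral>\<^sup>+x. ennreal \<bar>x\<bar> * indicator {a..b} x \<partial>lborel)"
    by (rule nn_integral_cong_AE)
       (use AE_lborel_singleton[of a] AE_lborel_singleton[of b] in eventually_elim, auto simp: indicator_def)
  also have "\<dots> = ennreal (?q b - ?q a)"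
    by (rule nn_integral_FTC_Icc)
       (use \<open>a \<le> b\<close> abs_antiderivative in \<open>auto intro: has_field_derivative_at_within\<close>)
  finally show "emeasure (distr (density lborel (\<lambda>x. ennreal \<bar>x\<bar>)) borel ?q) (box l u) =
      ennreal (\<Prod>b\<in>Basis. (u - l) \<bullet> b)"
    unfolding ab by simp
qed simp

lemma gamma1_eq: "gamma1 \<xi> = fst \<xi> * \<bar>fst \<xi>\<bar> / 2"
  by (simp add: gamma1_def power2_eq_square sgn_if)

lemma gamma_measurable [measurable]:
  "gamma1 \<in> borel_measurable (borel \<Otimes>\<^sub>M borel)" "gamma2 \<in> borel_measurable (borel \<Otimes>\<^sub>M borel)"
  unfolding gamma1_eq[abs_def] gamma2_def[abs_def] by measurable

lemma nn_integral_gamma: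
  assumes f[measurable]: "f \<in> borel_measurable (borel \<Otimes>\<^sub>M borel)"
  shows "(\<integral>\<^sup>+\<xi>. f (gamma1 \<xi>, gamma2 \<xi>) \<partial>(lborel \<Otimes>\<^sub>M lborel)) = (\<integral>\<^sup>+z. f z \<partial>(lborel \<Otimes>\<^sub>M lborel))"
proof -
  let ?q = "\<lambda>x::real. x * \<bar>x\<bar> / 2"
  define H where "H s = (\<integral>\<^sup>+t. f (s, t) \<partial>lborel)" for s
  have [measurable]: "H \<in> borel_measurable borel" unfolding H_def by measurable
  have inner: "(\<integral>\<^sup>+y. f (?q x, y / x) \<partial>lborel) = ennreal \<bar>x\<bar> * H (?q x)" if "x \<noteq> 0" for x
  proof -
    have "H (?q x) = ennreal \<bar>1 / x\<bar> * (\<integral>\<^sup>+y. f (?q x, 0 + (1 / x) * y) \<partial>lborel)"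
      unfolding H_def by (rule nn_integral_real_affine) (use that in auto)
    moreover have "ennreal \<bar>x\<bar> * ennreal \<bar>1 / x\<bar> = 1"
      using that by (simp flip: ennreal_mult)
    ultimately show ?thesis by (simp flip: mult.assoc)
  qed
  have "(\<integral>\<^sup>+\<xi>. f (gamma1 \<xi>, gamma2 \<xi>) \<partial>(lborel \<Otimes>\<^sub>M lborel)) = (\<integral>\<^sup>+x. \<integral>\<^sup>+y. f (?q x, y / x) \<partial>lborel \<partial>lborel)"
    by (subst lborel.nn_integral_fst[symmetric]) (simp_all add: gamma1_eq gamma2_def)
  also have "\<dots> = (\<integral>\<^sup>+x. ennreal \<bar>x\<bar> * H (?q x) \<partial>lborel)"
    by (rule nn_integral_cong_AE) (use AE_lborel_singleton[of 0] in eventually_elim, simp add: inner)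
  also have "\<dots> = (\<integral>\<^sup>+s. H s \<partial>distr (density lborel (\<lambda>x::real. ennreal \<bar>x\<bar>)) borel ?q)"
    by (simp add: nn_integral_distr nn_integral_density)
  also have "\<dots> = (\<integral>\<^sup>+z. f z \<partial>(lborel \<Otimes>\<^sub>M lborel))"
    unfolding distr_mult_abs H_def by (rule lborel.nn_integral_fst) simp
  finally show ?thesis .
qed

lemma distr_gamma:
  "distr (lborel \<Otimes>\<^sub>M lborel) (borel \<Otimes>\<^sub>M borel) (\<lambda>\<xi>. (gamma1 \<xi>, gamma2 \<xi>)) = lborel \<Otimes>\<^sub>M lborel"
proof (rule measure_eqI)
  fix A assume "A \<in> sets (distr (lborel \<Otimes>\<^sub>M lborel) (borel \<Otimes>\<^sub>M borel) (\<lambda>\<xi>. (gamma1 \<xi>, gamma2 \<xi>)))"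
  then have A: "A \<in> sets (borel \<Otimes>\<^sub>M borel)" "A \<in> sets (lborel \<Otimes>\<^sub>M lborel)" by (simp_all cong: sets_pair_measure_cong)
  have [measurable]: "(\<lambda>\<xi>. (gamma1 \<xi>, gamma2 \<xi>)) \<in> (lborel \<Otimes>\<^sub>M lborel) \<rightarrow>\<^sub>M (borel \<Otimes>\<^sub>M borel)" by measurable
  have "emeasure (distr (lborel \<Otimes>\<^sub>M lborel) (borel \<Otimes>\<^sub>M borel) (\<lambda>\<xi>. (gamma1 \<xi>, gamma2 \<xi>))) A
     = (\<integral>\<^sup>+z. indicator A z \<partial>distr (lborel \<Otimes>\<^sub>M lborel) (borel \<Otimes>\<^sub>M borel) (\<lambda>\<xi>. (gamma1 \<xi>, gamma2 \<xi>)))"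
    using A by simp
  also have "\<dots> = (\<integral>\<^sup>+\<xi>. indicator A (gamma1 \<xi>, gamma2 \<xi>) \<partial>(lborel \<Otimes>\<^sub>M lborel))"
    using A by (intro nn_integral_distr) auto
  also have "\<dots> = emeasure (lborel \<Otimes>\<^sub>M lborel) A"
    using A by (subst nn_integral_gamma) auto
  finally show "emeasure (distr (lborel \<Otimes>\<^sub>M lborel) (borel \<Otimes>\<^sub>M borel) (\<lambda>\<xi>. (gamma1 \<xi>, gamma2 \<xi>))) A
     = emeasure (lborel \<Otimes>\<^sub>M lborel) A" .
qed (simp cong: sets_pair_measure_cong)

definition tens :: "(real \<Rightarrow> complex) \<Rightarrow> (real \<Rightarrow> complex) \<Rightarrow> real \<times> real \<Rightarrow> complex" where
  "tens a b \<xi> = a (gamma1 \<xi>) * b (gamma2 \<xi>)"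

lemma integrable_tens:
  assumes "integrable lborel u" "integrable lborel v"
  shows "integrable lborel (tens u v)"
    and "integral\<^sup>L lborel (tens u v) = integral\<^sup>L lborel u * integral\<^sup>L lborel v"
proof -
  note [measurable] = assms[THEN borel_measurable_integrable, simplified]
  have [measurable]: "(\<lambda>\<xi>. (gamma1 \<xi>, gamma2 \<xi>)) \<in> (lborel \<Otimes>\<^sub>M lborel) \<rightarrow>\<^sub>M (borel \<Otimes>\<^sub>M borel)" by measurable
  have m: "(\<lambda>(s, t). u s * v t) \<in> borel_measurable (borel \<Otimes>\<^sub>M borel)" by measurable
  have i: "integrable (lborel \<Otimes>\<^sub>M lborel) (\<lambda>(s, t). u s * v t)"
    using integrable_lborel_pairI[OF assms, of "\<lambda>_. 1"] by simp
  have eq: "tens u v = (\<lambda>\<xi>. case (gamma1 \<xi>, gamma2 \<xi>) of (s, t) \<Rightarrow> u s * v t)"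
    by (simp add: tens_def[abs_def])
  show "integrable lborel (tens u v)"
    unfolding eq lborel_prod[symmetric]
    by (subst integrable_distr_eq[symmetric, of _ _ "borel \<Otimes>\<^sub>M borel"]) (use m i in \<open>simp_all add: distr_gamma\<close>)
  have "integral\<^sup>L lborel (tens u v) = integral\<^sup>L (lborel \<Otimes>\<^sub>M lborel) (\<lambda>(s, t). u s * v t)"
    unfolding eq lborel_prod[symmetric]
    by (subst integral_distr[symmetric, of _ _ "borel \<Otimes>\<^sub>M borel"]) (use m in \<open>simp_all add: distr_gamma\<close>)
  also have "\<dots> = (LINT s|lborel. LINT t|lborel. u s * v t)"
    using lborel_pair.integral_fst'[OF i] by simp
  finally show "integral\<^sup>L lborel (tens u v) = integral\<^sup>L lborel u * integral\<^sup>L lborel v" by simp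
qed

lemma tens_L2:
  assumes "a \<in> L2" "b \<in> L2"
  shows "tens a b \<in> L2"
proof -
  note [measurable] = assms[THEN L2_D(1)]
  have m: "tens a b \<in> borel_measurable borel" unfolding borel_prod[symmetric] tens_def[abs_def] by measurable
  have "integrable lborel (tens (\<lambda>s. of_real ((cmod (a s))\<^sup>2)) (\<lambda>t. of_real ((cmod (b t))\<^sup>2)))"
    using assms[THEN L2_D(2)] by (intro integrable_tens) (simp_all del: of_real_power)
  then have "integrable lborel (\<lambda>\<xi>. norm (tens (\<lambda>s. of_real ((cmod (a s))\<^sup>2)) (\<lambda>t. of_real ((cmod (b t))\<^sup>2)) \<xi>))"
    by (rule integrable_norm)
  then show ?thesis using m
    by (simp add: L2_def tens_def norm_mult norm_power power_mult_distrib)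
qed

lemma l2inner_tens:
  assumes "a \<in> L2" "b \<in> L2" "a' \<in> L2" "b' \<in> L2"
  shows "l2inner (tens a b) (tens a' b') = l2inner a a' * l2inner b b'"
proof -
  have "l2inner (tens a b) (tens a' b') = integral\<^sup>L lborel (tens (\<lambda>s. a s * cnj (a' s)) (\<lambda>t. b t * cnj (b' t)))"
    unfolding l2inner_def tens_def[abs_def] by (simp add: mult_ac)
  also have "\<dots> = l2inner a a' * l2inner b b'"
    unfolding l2inner_def using assms by (intro integrable_tens l2inner_integrable)
  finally show ?thesis .
qed

lemma l2norm_tens:
  assumes "a \<in> L2" "b \<in> L2"
  shows "l2norm (tens a b) = l2norm a * l2norm b"
proof -
  have "(l2norm (tens a b))\<^sup>2 = (l2norm a * l2norm b)\<^sup>2"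
    using l2inner_tens[OF assms assms] unfolding l2inner_self of_real_mult[symmetric] of_real_eq_iff
    by (simp add: power_mult_distrib)
  then show ?thesis by (simp add: power2_eq_iff_nonneg)
qed

lemma tens_linear:
  "tens (\<lambda>x. a x + a' x) b = (\<lambda>\<xi>. tens a b \<xi> + tens a' b \<xi>)"
  "tens (\<lambda>x. c * a x) b = (\<lambda>\<xi>. c * tens a b \<xi>)"
  "tens a (\<lambda>x. b x + b' x) = (\<lambda>\<xi>. tens a b \<xi> + tens a b' \<xi>)"
  "tens a (\<lambda>x. c * b x) = (\<lambda>\<xi>. c * tens a b \<xi>)"
  by (simp_all add: tens_def[abs_def] algebra_simps)

lemma tens_closed_span:
  assumes A: "A \<subseteq> L2" and B: "B \<subseteq> L2" and a: "a \<in> closed_span A" and b: "b \<in> closed_span B"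
  shows "tens a b \<in> closed_span {tens a b | a b. a \<in> A \<and> b \<in> B}" (is "_ \<in> closed_span ?T")
proof -
  have T: "?T \<subseteq> L2" using A B tens_L2 by blast
  note C = closed_subspace_closed_span[OF T]
  have bL: "b \<in> L2" using b closed_subspaceD(1)[OF closed_subspace_closed_span[OF B]] by blast
  have 1: "tens a b \<in> closed_span ?T" if a: "a \<in> A" for a
  proof -
    have aL: "a \<in> L2" using a A by blast
    show ?thesis
      by (rule closed_span_image[OF B C, where C = "l2norm a"])
         (use a b aL in \<open>auto simp: tens_L2 l2norm_tens tens_linear intro!: closed_span_superset[OF T]\<close>)
  qed
  show ?thesis
    by (rule closed_span_image[where T="\<lambda>a. tens a b", OF A C, where C = "l2norm b"])
       (use a bL 1 in \<open>auto simp: tens_L2 l2norm_tens tens_linear\<close>)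
qed

definition dil :: "real \<Rightarrow> real \<Rightarrow> (real \<times> real \<Rightarrow> complex) \<Rightarrow> real \<times> real \<Rightarrow> complex" where
  "dil p q g \<xi> = of_real (sqrt (p * q)) * g (p * fst \<xi>, q * snd \<xi>)"

lemma dil_L2:
  assumes g: "g \<in> L2" and "p > 0" "q > 0"
  shows "dil p q g \<in> L2" "l2norm (dil p q g) = l2norm g"
proof -
  note [measurable] = L2_D(1)[OF g, folded borel_prod]
  define f where "f z = (cmod (g z))\<^sup>2" for z
  have [measurable]: "f \<in> borel_measurable (borel \<Otimes>\<^sub>M borel)" unfolding f_def by measurable
  have m: "dil p q g \<in> borel_measurable borel" unfolding borel_prod[symmetric] dil_def[abs_def] by measurable
  have inner: "(\<integral>\<^sup>+y. ennreal (f (x, q * y)) \<partial>lborel) = ennreal (1 / q) * (\<integral>\<^sup>+y. ennreal (f (x, y)) \<partial>lborel)" for x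
    using nn_integral_real_affine[of "\<lambda>y. ennreal (f (x, y))" q 0] \<open>q > 0\<close>
    by (simp flip: mult.assoc ennreal_mult)
  have outer: "(\<integral>\<^sup>+x. h (p * x) \<partial>lborel) = ennreal (1 / p) * (\<integral>\<^sup>+x. h x \<partial>lborel)"
    if "h \<in> borel_measurable borel" for h :: "real \<Rightarrow> ennreal"
    using nn_integral_real_affine[of h p 0] that \<open>p > 0\<close> by (simp flip: mult.assoc ennreal_mult)
  have "(\<integral>\<^sup>+\<xi>. ennreal ((cmod (dil p q g \<xi>))\<^sup>2) \<partial>lborel) =
     (\<integral>\<^sup>+\<xi>. ennreal (p * q) * ennreal (f (p * fst \<xi>, q * snd \<xi>)) \<partial>(lborel \<Otimes>\<^sub>M lborel))"
    unfolding lborel_prod using assms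
    by (intro nn_integral_cong) (simp add: dil_def f_def norm_mult power_mult_distrib flip: ennreal_mult)
  also have "\<dots> = ennreal (p * q) * (\<integral>\<^sup>+\<xi>. ennreal (f (p * fst \<xi>, q * snd \<xi>)) \<partial>(lborel \<Otimes>\<^sub>M lborel))"
    by (rule nn_integral_cmult) measurable
  also have "(\<integral>\<^sup>+\<xi>. ennreal (f (p * fst \<xi>, q * snd \<xi>)) \<partial>(lborel \<Otimes>\<^sub>M lborel)) =
      (\<integral>\<^sup>+x. \<integral>\<^sup>+y. ennreal (f (p * x, q * y)) \<partial>lborel \<partial>lborel)"
    by (subst lborel.nn_integral_fst[symmetric]) simp_all
  also have "\<dots> = ennreal (1 / q) * (\<integral>\<^sup>+x. \<integral>\<^sup>+y. ennreal (f (p * x, y)) \<partial>lborel \<partial>lborel)"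
    unfolding inner by (rule nn_integral_cmult) measurable
  also have "(\<integral>\<^sup>+x. \<integral>\<^sup>+y. ennreal (f (p * x, y)) \<partial>lborel \<partial>lborel) =
      ennreal (1 / p) * (\<integral>\<^sup>+x. \<integral>\<^sup>+y. ennreal (f (x, y)) \<partial>lborel \<partial>lborel)"
    by (rule outer) measurable
  also have "(\<integral>\<^sup>+x. \<integral>\<^sup>+y. ennreal (f (x, y)) \<partial>lborel \<partial>lborel) = (\<integral>\<^sup>+z. ennreal (f z) \<partial>(lborel \<Otimes>\<^sub>M lborel))"
    by (rule lborel.nn_integral_fst) measurable
  also have "\<dots> = ennreal ((l2norm g)\<^sup>2)"
    unfolding lborel_prod f_def by (rule nn_integral_l2norm[OF g])
  finally have eq: "(\<integral>\<^sup>+\<xi>. ennreal ((cmod (dil p q g \<xi>))\<^sup>2) \<partial>lborel) = ennreal ((l2norm g)\<^sup>2)"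
    using assms by (simp flip: ennreal_mult)
  show L: "dil p q g \<in> L2" using L2_nn_integralI(1)[OF m, of "l2norm g"] eq by simp
  show "l2norm (dil p q g) = l2norm g"
    using eq unfolding nn_integral_l2norm[OF L] by (simp add: power2_eq_iff_nonneg)
qed

lemma dil_inverse: "p > 0 \<Longrightarrow> q > 0 \<Longrightarrow> dil p q (dil (1 / p) (1 / q) g) = g"
  by (auto simp: dil_def fun_eq_iff real_sqrt_mult real_sqrt_divide simp flip: of_real_mult)

lemma dil_cong_AE:
  assumes "f \<in> L2" "g \<in> L2" "p > 0" "q > 0" "AE x in lborel. f x = g x"
  shows "AE x in lborel. dil p q f x = dil p q g x"
proof -
  have "l2norm (\<lambda>x. f x - g x) = 0" using assms by (subst l2norm_eq_0_iff) (auto intro: L2_diff)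
  then have "l2norm (dil p q (\<lambda>x. f x - g x)) = 0" using dil_L2(2)[OF L2_diff] assms by simp
  then have "AE x in lborel. dil p q (\<lambda>x. f x - g x) x = 0"
    using assms by (subst (asm) l2norm_eq_0_iff) (auto intro!: dil_L2 L2_diff)
  then show ?thesis by eventually_elim (simp add: dil_def right_diff_distrib)
qed

lemma dil_closed_span:
  assumes S: "S \<subseteq> L2" and U: "closed_subspace U" and "p > 0" "q > 0"
    and T: "\<And>s. s \<in> S \<Longrightarrow> dil p q s \<in> U" and f: "f \<in> closed_span S"
  shows "dil p q f \<in> U"
  by (rule closed_span_image[OF S U T, where C = 1])
     (use assms dil_L2 in \<open>auto simp: dil_def[abs_def] algebra_simps\<close>)

lemma dilation_hat_1: "dilation_hat 1 = dil (1 / 4) (1 / 2)"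
proof -
  have "(2::real) powr (- 3 / 2) = (2 powr (- 3)) powr (1 / 2)" by (simp add: powr_powr)
  also have "(2::real) powr (- 3) = 1 / 4 * (1 / 2)" by (simp add: powr_minus_divide)
  finally have "(2::real) powr (- 3 / 2) = sqrt (1 / 4 * (1 / 2))" by (simp add: powr_half_sqrt)
  then show ?thesis by (auto simp: dilation_hat_def dil_def fun_eq_iff power_int_minus field_simps)
qed

lemma dil_tens:
  assumes "r > 0"
  shows "dil (r\<^sup>2) r (tens a b) = (\<lambda>\<xi>. of_real (sqrt (r\<^sup>2 * r)) * tens (\<lambda>s. a (r ^ 4 * s)) (\<lambda>t. b (t / r)) \<xi>)"
proof -
  have "gamma1 (r\<^sup>2 * fst \<xi>, r * snd \<xi>) = r ^ 4 * gamma1 \<xi>" for \<xi>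
    using assms by (simp add: gamma1_eq abs_mult power4_eq_xxxx power2_eq_square)
  moreover have "gamma2 (r\<^sup>2 * fst \<xi>, r * snd \<xi>) = gamma2 \<xi> / r" for \<xi>
    using assms by (simp add: gamma2_def power2_eq_square)
  ultimately show ?thesis by (simp add: dil_def[abs_def] tens_def[abs_def])
qed

section \<open>The two-scale relation\<close>

definition tset :: "(real \<Rightarrow> complex) set \<Rightarrow> (real \<Rightarrow> complex) set \<Rightarrow> (real \<times> real \<Rightarrow> complex) set" where
  "tset A B = {tens a b | a b. a \<in> A \<and> b \<in> B}"

lemma tset_L2: "A \<subseteq> L2 \<Longrightarrow> B \<subseteq> L2 \<Longrightarrow> tset A B \<subseteq> L2"
  unfolding tset_def using tens_L2 by blast

definition window :: "(real \<Rightarrow> complex) \<Rightarrow> real \<Rightarrow> int \<Rightarrow> int \<Rightarrow> real \<Rightarrow> complex" where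
  "window w b m k t = cis (2 * pi * of_int m * b * t) * w (t - of_int k)"

definition translates :: "('i \<Rightarrow> real \<Rightarrow> complex) \<Rightarrow> 'i set \<Rightarrow> (real \<Rightarrow> complex) set" where
  "translates h I = {(\<lambda>x. h i (of_int m + x)) | i (m::int). i \<in> I}"

definition modulates :: "('i \<Rightarrow> real \<Rightarrow> complex) \<Rightarrow> 'i set \<Rightarrow> (real \<Rightarrow> complex) set" where
  "modulates h I = {(\<lambda>s. cis (2 * pi * of_int m * s) * fourier (h i) s) | i (m::int). i \<in> I}"

lemma has_fourier_translate_int:
  fixes h :: "real \<Rightarrow> complex"
  assumes "h \<in> L2"
  shows "has_fourier (\<lambda>x. h (of_int m + x)) (\<lambda>s. cis (2 * pi * of_int m * s) * fourier h s)"
  using has_fourier_shift[OF has_fourier_fourier[OF assms], of "of_int m"] by (simp add: mult_ac)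

lemma modulates_L2:
  assumes "\<And>i. i \<in> I \<Longrightarrow> h i \<in> L2"
  shows "modulates h I \<subseteq> L2"
  using has_fourier_L2(2)[OF has_fourier_translate_int] assms by (auto simp: modulates_def)

lemma translates_L2:
  assumes "\<And>i. i \<in> I \<Longrightarrow> h i \<in> L2"
  shows "translates h I \<subseteq> L2"
  using has_fourier_L2(1)[OF has_fourier_translate_int] assms by (auto simp: translates_def)

lemma atom_hat_eq:
  "atom_hat h w b k m = tens (\<lambda>s. cis (2 * pi * of_int (fst m) * s) * fourier h s) (window w b (snd m) k)"
  by (simp add: fun_eq_iff atom_hat_def tens_def window_def mult_ac)

lemma atom_space:
  assumes h: "\<And>i. i \<in> I \<Longrightarrow> h i \<in> L2" and w: "\<And>m k. window w b m k \<in> L2"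
    and fg: "has_fourier f g"
  shows "f \<in> closed_span {inverse_fourier (atom_hat (h i) w b k m) | i k m. i \<in> I} \<longleftrightarrow>
    g \<in> closed_span (tset (modulates h I) {window w b m k | m k. True})" (is "_ \<in> closed_span ?S \<longleftrightarrow> _ \<in> closed_span ?T")
proof -
  have T: "?T = {atom_hat (h i) w b k m | i k m. i \<in> I}"
    unfolding tset_def modulates_def atom_hat_eq
    by (auto; metis fst_conv snd_conv)
  have TL: "?T \<subseteq> L2" using w by (intro tset_L2 modulates_L2 h) auto
  have hf: "has_fourier (inverse_fourier t) t" if "t \<in> ?T" for t
    using has_fourier_inverse_fourier TL that by blast
  have S: "?S = inverse_fourier ` ?T" unfolding T by blast
  show ?thesis
    unfolding S by (rule has_fourier_closed_span[OF fg _ TL]) (use hf has_fourier_L2(1) in blast)+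
qed

lemma translates_modulates:
  assumes h: "\<And>i. i \<in> I \<Longrightarrow> h i \<in> L2" and fg: "has_fourier f g"
  shows "f \<in> closed_span (translates h I) \<longleftrightarrow> g \<in> closed_span (modulates h I)"
proof (rule has_fourier_closed_span[OF fg translates_L2[OF h] modulates_L2[OF h]])
  show "\<exists>t\<in>modulates h I. has_fourier s t" if s: "s \<in> translates h I" for s
  proof -
    obtain i m where "s = (\<lambda>x. h i (of_int m + x))" "i \<in> I" using s by (auto simp: translates_def)
    then show ?thesis using has_fourier_translate_int[OF h] unfolding modulates_def by blast
  qed
  show "\<exists>s\<in>translates h I. has_fourier s t" if t: "t \<in> modulates h I" for t
  proof -
    obtain i m where "t = (\<lambda>s. cis (2 * pi * of_int m * s) * fourier (h i) s)" "i \<in> I"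
      using t by (auto simp: modulates_def)
    then show ?thesis using has_fourier_translate_int[OF h] unfolding translates_def by blast
  qed
qed

lemma l2inner_modulates:
  assumes "\<And>i. i \<in> I \<Longrightarrow> h i \<in> L2" "\<And>i. i \<in> I' \<Longrightarrow> h' i \<in> L2"
    and orth: "\<And>f g. f \<in> translates h I \<Longrightarrow> g \<in> translates h' I' \<Longrightarrow> l2inner f g = 0"
    and "f \<in> modulates h I" "g \<in> modulates h' I'"
  shows "l2inner f g = 0"
proof -
  obtain i m where f: "f = (\<lambda>s. cis (2 * pi * of_int m * s) * fourier (h i) s)" "i \<in> I"
    using assms(4) by (auto simp: modulates_def)
  obtain i' m' where g: "g = (\<lambda>s. cis (2 * pi * of_int m' * s) * fourier (h' i') s)" "i' \<in> I'"
    using assms(5) by (auto simp: modulates_def)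
  have "l2inner f g = l2inner (\<lambda>x. h i (of_int m + x)) (\<lambda>x. h' i' (of_int m' + x))"
    unfolding f g using assms f g by (intro has_fourier_inner[symmetric] has_fourier_translate_int) auto
  also have "\<dots> = 0" by (rule orth) (use f g in \<open>auto simp: translates_def\<close>)
  finally show ?thesis .
qed

lemma translates_minus:
  "{(\<lambda>x. h i (x - of_int k)) | i (k::int). i \<in> I} = translates h I"
  unfolding translates_def
  by (auto; metis (no_types, opaque_lifting) add.commute diff_minus_eq_add minus_minus of_int_minus uminus_add_conv_diff)

lemma dil_closed_span_tset:
  assumes A: "A \<subseteq> L2" and B: "B \<subseteq> L2" and A': "A' \<subseteq> L2" and total: "closed_span B = L2" and "r > 0"
    and AA': "\<And>a. a \<in> A \<Longrightarrow> (\<lambda>s. a (r ^ 4 * s)) \<in> closed_span A'"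
    and f: "f \<in> closed_span (tset A B)"
  shows "dil (r\<^sup>2) r f \<in> closed_span (tset A' B)"
proof (rule dil_closed_span[OF tset_L2[OF A B] closed_subspace_closed_span[OF tset_L2[OF A' B]] _ _ _ f])
  fix s assume "s \<in> tset A B"
  then obtain a b where s: "s = tens a b" "a \<in> A" "b \<in> B" by (auto simp: tset_def)
  have "(\<lambda>t. b (t / r)) \<in> closed_span B"
    unfolding total using L2_dilate(1)[of b "1 / r"] s(3) B \<open>r > 0\<close> by auto
  then have "tens (\<lambda>s. a (r ^ 4 * s)) (\<lambda>t. b (t / r)) \<in> closed_span (tset A' B)"
    unfolding tset_def using AA' s by (intro tens_closed_span A' B) auto
  then show "dil (r\<^sup>2) r s \<in> closed_span (tset A' B)"
    unfolding s dil_tens[OF \<open>r > 0\<close>]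
    by (rule closed_subspaceD(4)[OF closed_subspace_closed_span[OF tset_L2[OF A' B]]])
qed (use \<open>r > 0\<close> in auto)

theorem theorem3p2:
  fixes V :: "int \<Rightarrow> (real \<Rightarrow> complex) set"
    and \<phi> :: "real \<Rightarrow> complex"
    and \<psi> :: "nat \<Rightarrow> real \<Rightarrow> complex"
    and w :: "real \<Rightarrow> complex"
    and b :: real
  assumes "mra 16 V \<phi>"
    and "mra_wavelets 16 V \<psi>"
    and "b > 0"
    and "w \<in> L2"
    and "l2norm w = 1"
    and "tight_frame (1 / b) L2 UNIV
           (\<lambda>(m::int, k::int) x. cis (2 * pi * of_int m * b * x) * w (x - of_int k))"
  shows "is_orthogonal_sum (V0_space \<phi> w b) (W0_space \<psi> w b)
           (dilated_space 1 (V0_space \<phi> w b))"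
proof -
  define I :: "nat set" where "I = {1..15}"
  define F0 F1 where "F0 = translates (\<lambda>_::unit. \<phi>) UNIV" and "F1 = translates \<psi> I"
  define A0 A1 where "A0 = modulates (\<lambda>_::unit. \<phi>) UNIV" and "A1 = modulates \<psi> I"
  define B where "B = {window w b m k | m k. True}"
  define P Q where "P = closed_span (tset A0 B)" and "Q = closed_span (tset A1 B)"

  have V: "closed_subspace (V j)" "V j \<subseteq> V (j + 1)" "f \<in> V j \<longleftrightarrow> (\<lambda>x. f (16 * x)) \<in> V (j + 1)" for j f
    using assms(1) by (auto simp: mra_def)
  have onb: "orthonormal_basis (V 0) UNIV (\<lambda>(k::int) x. \<phi> (x - of_int k))"
    using assms(1) by (simp add: mra_def)
  have V01: "V 0 \<subseteq> V 1" using V(2)[of 0] by simp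
  have V0_iff: "f \<in> V 0 \<longleftrightarrow> (\<lambda>x. f (16 * x)) \<in> V 1" for f using V(3)[of f 0] by simp
  have onbW: "orthonormal_basis {f \<in> V 1. \<forall>g\<in>V 0. l2inner f g = 0} (I \<times> (UNIV :: int set))
       (\<lambda>(l, k) x. \<psi> l (x - of_int k))"
    using assms(2) by (simp add: mra_wavelets_def I_def)
  have \<phi>: "\<phi> \<in> L2"
  proof -
    have "(\<lambda>x. \<phi> (x - of_int k)) \<in> L2" for k using onb by (simp add: orthonormal_basis_def)
    from this[of 0] show ?thesis by simp
  qed
  have \<psi>: "\<psi> i \<in> L2" if "i \<in> I" for i
  proof -
    have "(\<lambda>x. \<psi> i (x - of_int k)) \<in> L2" for k using onbW that by (simp add: orthonormal_basis_def)
    from this[of 0] show ?thesis by simp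
  qed
  have V0: "closed_span F0 = V 0"
  proof -
    have "F0 = (\<lambda>(k::int) x. \<phi> (x - of_int k)) ` UNIV"
      unfolding F0_def translates_minus[symmetric] by auto
    then show ?thesis using onb by (simp add: orthonormal_basis_def)
  qed
  have W0: "closed_span F1 = {f \<in> V 1. \<forall>g\<in>V 0. l2inner f g = 0}"
  proof -
    have "F1 = (\<lambda>(l, k::int) x. \<psi> l (x - of_int k)) ` (I \<times> UNIV)"
      unfolding F1_def translates_minus[symmetric] by auto
    then show ?thesis using onbW by (simp add: orthonormal_basis_def)
  qed
  have F: "F0 \<subseteq> L2" "F1 \<subseteq> L2" unfolding F0_def F1_def using \<phi> \<psi> by (auto intro!: translates_L2)
  have A: "A0 \<subseteq> L2" "A1 \<subseteq> L2" unfolding A0_def A1_def using \<phi> \<psi> by (auto intro!: modulates_L2)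
  have B: "closed_span B = L2" "B \<subseteq> L2"
  proof -
    have e: "B = (\<lambda>(m::int, k::int) x. cis (2 * pi * of_int m * b * x) * w (x - of_int k)) ` UNIV"
      unfolding B_def window_def[abs_def] by auto
    show "closed_span B = L2" unfolding e by (rule tight_frame_total[OF assms(6)]) (use assms(3) in simp)
    show "B \<subseteq> L2" unfolding e using assms(6) by (auto simp: tight_frame_def)
  qed
  have win: "window w b m k \<in> L2" for m k using B(2) by (auto simp: B_def)
  have TP: "tset A0 B \<subseteq> L2" and TQ: "tset A1 B \<subseteq> L2" by (intro tset_L2 A B)+
  note CP = closed_subspace_closed_span[OF TP, folded P_def] and CQ = closed_subspace_closed_span[OF TQ, folded Q_def]

  have V0_hat: "f \<in> V0_space \<phi> w b \<longleftrightarrow> g \<in> P" if "has_fourier f g" for f g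
    using atom_space[where h="\<lambda>_::unit. \<phi>" and I=UNIV, OF \<phi> win that]
    by (simp add: V0_space_def Phi0_def P_def A0_def B_def)
  have W0_hat: "f \<in> W0_space \<psi> w b \<longleftrightarrow> g \<in> Q" if "has_fourier f g" for f g
    using atom_space[where h=\<psi> and I=I, OF \<psi> win that]
    by (simp add: W0_space_def Psi0_def Q_def A1_def B_def I_def)

  have orthF: "l2inner f g = 0" if "f \<in> F0" "g \<in> F1" for f g
  proof -
    have "f \<in> V 0" "g \<in> closed_span F1" using that closed_span_superset F V0 by blast+
    then have "l2inner g f = 0" unfolding W0 by simp
    then show ?thesis by (subst l2inner_commute) simp
  qed
  have orthA: "l2inner f g = 0" if "f \<in> A0" "g \<in> A1" for f g
    using l2inner_modulates[of UNIV "\<lambda>_::unit. \<phi>" I \<psi>, OF \<phi> \<psi> orthF] that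
    by (simp add: A0_def A1_def F0_def F1_def)
  have orthT: "l2inner f g = 0" if "f \<in> tset A0 B" "g \<in> tset A1 B" for f g
    using that orthA A B(2) by (auto simp: tset_def l2inner_tens subset_iff)
  have orthPQ: "l2inner f g = 0" if "f \<in> P" "g \<in> Q" for f g
    using closed_span_orthogonal[OF TP TQ orthT] that by (auto simp: P_def Q_def)

  have V1_sub: "V 1 \<subseteq> closed_span (F0 \<union> F1)"
  proof
    fix f assume f: "f \<in> V 1"
    then have fL: "f \<in> L2" using closed_subspaceD(1)[OF V(1)] by blast
    obtain p where p: "p \<in> V 0" "\<And>g. g \<in> V 0 \<Longrightarrow> l2inner (\<lambda>x. f x - p x) g = 0"
      using orthogonal_projection[OF V(1) fL] by blast
    have "(\<lambda>x. f x - p x) \<in> V 1" using p(1) V01 by (intro closed_subspace_diff[OF V(1) f]) blast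
    then have "(\<lambda>x. f x - p x) \<in> closed_span F1" unfolding W0 using p(2) by simp
    moreover have "p \<in> closed_span F0" using p(1) V0 by simp
    ultimately have "p \<in> closed_span (F0 \<union> F1)" "(\<lambda>x. f x - p x) \<in> closed_span (F0 \<union> F1)"
      using closed_span_mono[of F0 "F0 \<union> F1"] closed_span_mono[of F1 "F0 \<union> F1"] F by blast+
    from closed_subspaceD(3)[OF closed_subspace_closed_span this] F
    show "f \<in> closed_span (F0 \<union> F1)" by simp
  qed
  have A01: "A0 \<union> A1 = modulates (case_sum (\<lambda>_::unit. \<phi>) \<psi>) (UNIV <+> I)"
    and F01: "F0 \<union> F1 = translates (case_sum (\<lambda>_::unit. \<phi>) \<psi>) (UNIV <+> I)"
    unfolding A0_def A1_def F0_def F1_def modulates_def translates_def by (auto; force)+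
  have F01_A01: "f \<in> closed_span (F0 \<union> F1) \<longleftrightarrow> g \<in> closed_span (A0 \<union> A1)" if "has_fourier f g" for f g
    unfolding A01 F01 by (rule translates_modulates[OF _ that]) (use \<phi> \<psi> in auto)
  have F0_A0: "f \<in> V 0 \<longleftrightarrow> g \<in> closed_span A0" if "has_fourier f g" for f g
    using translates_modulates[of UNIV "\<lambda>_::unit. \<phi>", OF \<phi> that] by (simp add: A0_def F0_def V0[symmetric])

  have up: "(\<lambda>s. a ((1 / 2) ^ 4 * s)) \<in> closed_span (A0 \<union> A1)" if a: "a \<in> A0" for a
  proof -
    have aL: "a \<in> L2" using a A by blast
    obtain f where f: "has_fourier f a" using has_fourier_ex_inverse[OF aL] by blast
    then have "f \<in> V 0" using F0_A0 closed_span_superset[OF A(1) a] by blast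
    then have "(\<lambda>x. f (16 * x)) \<in> closed_span (F0 \<union> F1)" using V0_iff V1_sub by blast
    then have "(\<lambda>s. of_real (1 / 16) * a (s / 16)) \<in> closed_span (A0 \<union> A1)"
      using F01_A01[OF has_fourier_dilate[OF f, of 16]] by simp
    from closed_subspaceD(4)[OF closed_subspace_closed_span this, of 16] A
    show ?thesis by (simp add: field_simps)
  qed
  have down: "(\<lambda>s. a (2 ^ 4 * s)) \<in> closed_span A0" if a: "a \<in> A0 \<union> A1" for a
  proof -
    have aL: "a \<in> L2" using a A by blast
    obtain f where f: "has_fourier f a" using has_fourier_ex_inverse[OF aL] by blast
    have "f \<in> closed_span (F0 \<union> F1)" using F01_A01[OF f] closed_span_superset[of "A0 \<union> A1" a] a A by blast
    moreover have "closed_span (F0 \<union> F1) \<subseteq> V 1"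
      by (rule closed_span_minimal[OF V(1)]) (use V01 V0 W0 closed_span_superset F in blast)
    ultimately have "f \<in> V 1" by blast
    then have "(\<lambda>x. f (1 / 16 * x)) \<in> V 0" using V0_iff[of "\<lambda>x. f (1 / 16 * x)"] by simp
    then have "(\<lambda>s. of_real (1 / (1 / 16)) * a (s / (1 / 16))) \<in> closed_span A0"
      using F0_A0[OF has_fourier_dilate[OF f, of "1 / 16"]] by simp
    from closed_subspaceD(4)[OF closed_subspace_closed_span[OF A(1)] this, of "1 / 16"]
    show ?thesis by (simp add: mult.commute)
  qed
  define R where "R = closed_span (tset (A0 \<union> A1) B)"
  have TR: "tset (A0 \<union> A1) B = tset A0 B \<union> tset A1 B" by (auto simp: tset_def)
  have TRL: "tset (A0 \<union> A1) B \<subseteq> L2" unfolding TR using TP TQ by blast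
  note CR = closed_subspace_closed_span[OF TRL, folded R_def]
  have PR: "P \<subseteq> R" and QR: "Q \<subseteq> R"
    unfolding P_def Q_def R_def using TRL by (intro closed_span_mono; simp add: TR)+
  have D_up: "dil (1 / 4) (1 / 2) g \<in> R" if "g \<in> P" for g
    using dil_closed_span_tset[OF A(1) B(2) _ B(1) _ up] that A
    by (simp add: P_def R_def power2_eq_square)
  have D_down: "dil 4 2 g \<in> P" if "g \<in> R" for g
    using dil_closed_span_tset[where A = "A0 \<union> A1", OF _ B(2) A(1) B(1) _ down] that A
    by (simp add: P_def R_def power2_eq_square)

  have "(\<lambda>x. f x + g x) \<in> dilated_space 1 (V0_space \<phi> w b)"
    if fg: "f \<in> V0_space \<phi> w b" "g \<in> W0_space \<psi> w b" for f g
  proof -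
    have "f \<in> L2" "g \<in> L2" using that by (auto simp: V0_space_def W0_space_def closed_span_def l2_tendsto_def)
    then obtain f' g' where f': "has_fourier f f'" and g': "has_fourier g g'" using has_fourier_ex by metis
    define G where "G x = f' x + g' x" for x
    have hG: "has_fourier (\<lambda>x. f x + g x) G" unfolding G_def[abs_def] by (rule has_fourier_add[OF f' g'])
    have "f' \<in> R" "g' \<in> R" using V0_hat[OF f'] W0_hat[OF g'] fg PR QR by auto
    then have "G \<in> R" unfolding G_def[abs_def] by (rule closed_subspaceD(3)[OF CR])
    then have DG: "dil 4 2 G \<in> P" by (rule D_down)
    then have DGL: "dil 4 2 G \<in> L2" using closed_subspaceD(1)[OF CP] by blast
    then obtain h where h: "has_fourier h (dil 4 2 G)" using has_fourier_ex_inverse by blast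
    have hL: "h \<in> L2" by (rule has_fourier_L2(1)[OF h])
    have h': "has_fourier h (fourier h)" by (rule has_fourier_fourier[OF hL])
    have "AE x in lborel. dil (1 / 4) (1 / 2) (dil 4 2 G) x = dil (1 / 4) (1 / 2) (fourier h) x"
      by (intro dil_cong_AE DGL has_fourier_L2(2)[OF h'] has_fourier_unique[OF h h']) auto
    then have "AE x in lborel. G x = dilation_hat 1 (fourier h) x"
      using dil_inverse[of "1 / 4" "1 / 2" G] by (simp add: dilation_hat_1)
    moreover have "dilation_hat 1 (fourier h) \<in> borel_measurable borel"
      unfolding dilation_hat_1 by (intro L2_D(1) dil_L2 has_fourier_L2(2)[OF h']) auto
    ultimately have "has_fourier (\<lambda>x. f x + g x) (dilation_hat 1 (fourier h))"
      using has_fourier_cong_AE[OF hG] by blast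
    moreover have "h \<in> V0_space \<phi> w b" using V0_hat[OF h] DG by simp
    ultimately show ?thesis by (auto simp: dilated_space_def)
  qed
  moreover have "\<exists>f g. F = (\<lambda>x. f x + g x) \<and> f \<in> V0_space \<phi> w b \<and> g \<in> W0_space \<psi> w b"
    if FD: "F \<in> dilated_space 1 (V0_space \<phi> w b)" for F
  proof -
    obtain h where h: "h \<in> V0_space \<phi> w b" "has_fourier F (dil (1 / 4) (1 / 2) (fourier h))"
      using FD by (auto simp: dilated_space_def dilation_hat_1)
    define G where "G = dil (1 / 4) (1 / 2) (fourier h)"
    have "h \<in> L2" using h(1) by (auto simp: V0_space_def closed_span_def l2_tendsto_def)
    then have "fourier h \<in> P" using V0_hat has_fourier_fourier h(1) by blast
    then have "G \<in> R" unfolding G_def by (rule D_up)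
    then obtain p where p: "p \<in> P" "(\<lambda>x. G x - p x) \<in> Q"
      using closed_span_Un_decompose[OF TP TQ orthT] unfolding R_def TR P_def Q_def by blast
    have "p \<in> L2" using p(1) closed_subspaceD(1)[OF CP] by blast
    then obtain f where f: "has_fourier f p" using has_fourier_ex_inverse by blast
    have "has_fourier (\<lambda>x. F x - f x) (\<lambda>x. G x - p x)"
      using has_fourier_diff[OF h(2) f] by (simp add: G_def)
    then have "(\<lambda>x. F x - f x) \<in> W0_space \<psi> w b" using W0_hat p(2) by blast
    moreover have "f \<in> V0_space \<phi> w b" using V0_hat[OF f] p(1) by simp
    ultimately show ?thesis by (intro exI[of _ f] exI[of _ "\<lambda>x. F x - f x"]) simp
  qed
  moreover have "l2inner f g = 0" if fg: "f \<in> V0_space \<phi> w b" "g \<in> W0_space \<psi> w b" for f g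
  proof -
    have "f \<in> L2" "g \<in> L2" using that by (auto simp: V0_space_def W0_space_def closed_span_def l2_tendsto_def)
    then obtain f' g' where f': "has_fourier f f'" and g': "has_fourier g g'" using has_fourier_ex by metis
    then show ?thesis
      using has_fourier_inner[OF f' g'] orthPQ V0_hat[OF f'] W0_hat[OF g'] fg by simp
  qed
  ultimately show ?thesis unfolding is_orthogonal_sum_def by blast
qed

end
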